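(* For the coded caching problem with $N=3$ files and $K=3$ users, the linear memory-rate trade-off is, for every cache size $M\in[0,3]$, \[ R^*_L(M)=\max\left\{3-3M,\ \frac{8-6M}{3},\ \frac{15-10M}{6},\ \frac{9-5M}{4},\ \frac{5-2M}{3},\ \frac{3-M}{3}\right\}. \] In particular, every linear-achievable pair $(M,R)$ satisfies $10M+6R\ge 15$ and $5M+4R\ge 9$, and the pair $(M,R)=(3/5,3/2)$ is linear-achievable.
   Context: Coded caching problem with $N=3$ files and $K=3$ users: a server holds three independent files $W_1,W_2,W_3$, each uniformly distributed over $[2^F]$ ($F$ bits). It is connected to 3 users by a shared error-free link; each user $k$ has a cache of $MF$ bits. In the placement phase (before demands are known) user $k$ stores $Z_k=\phi_k(W_1,W_2,W_3)\in[2^{MF}]$. In the delivery phase each user $k$ requests a file $W_{d_k}$, $d_k\in\{1,2,3\}$; for each demand vector $D=(d_1,d_2,d_3)\in\{1,2,3\}^3$ the server sends $X^D=f^D(W_1,W_2,W_3)\in[2^{RF}]$, and user $k$ must reconstruct $W_{d_k}$ from $(Z_k,X^D)$ with zero error, for every $D$. A pair $(M,R)$ is achievable if for all large enough $F$ such a scheme exists. A scheme is linear if all cache contents $Z_k$ and all delivery messages $X^D$ are linear block codes of the files, i.e., each is a linear function (over a finite field) of the concatenation of the file symbols. A pair $(M,R)$ is linear-achievable if for all large enough $F$ a linear zero-error scheme with these parameters exists; $\mathcal{R}_L$ is the closure of the set of linear-achievable pairs and $R^*_L(M)=\inf\{R:(M,R)\in\mathcal{R}_L\}$.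
   Formalization: Linear-achievable here asks for a linear scheme at some file length instead of all large enough F, since (3/5,3/2) fails for F=10n+1 by rounding of MF and RF; lengths are counted in symbols of any finite field. *)

theory Defs
  imports "HOL-Analysis.Analysis" "HOL-Algebra.Algebra"
begin

text \<open>Linear coded caching with N = 3 files and K = 3 users (files, users and
demands are indexed by 0,1,2).  A linear scheme works over some finite field Fq
(represented, up to isomorphism, with carrier a set of naturals).  Each file consists
of L symbols of Fq (F = L log2 q bits); the concatenation of the three files is the
vector w of length 3L, where symbol i of file n is w (n*L + i).  A linear block code
with r output symbols is an r x 3L matrix A over Fq, output symbol i being
the sum over j < 3L of A i j * w j.  A cache of M F bits holds m symbols with
q^m <= 2^(M F), i.e. m <= M L; likewise a delivery message has r <= R L symbols.\<close>

definition is_vec :: "nat ring \<Rightarrow> nat \<Rightarrow> (nat \<Rightarrow> nat) \<Rightarrow> bool" where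
  "is_vec Fq n w \<longleftrightarrow> (\<forall>j<n. w j \<in> carrier Fq)"

definition is_mat :: "nat ring \<Rightarrow> nat \<Rightarrow> nat \<Rightarrow> (nat \<Rightarrow> nat \<Rightarrow> nat) \<Rightarrow> bool" where
  "is_mat Fq r n A \<longleftrightarrow> (\<forall>i<r. \<forall>j<n. A i j \<in> carrier Fq)"

definition lin_row :: "nat ring \<Rightarrow> (nat \<Rightarrow> nat \<Rightarrow> nat) \<Rightarrow> nat \<Rightarrow> nat \<Rightarrow> (nat \<Rightarrow> nat) \<Rightarrow> nat" where
  "lin_row Fq A n i w = finsum Fq (\<lambda>j. mult Fq (A i j) (w j)) {..<n}"

text \<open>Zero-error decodability of file d from the cache (m symbols, matrix C) and the
delivery message (r symbols, matrix Y): the pair (cache content, message) determines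
the requested file, i.e. a decoding function exists.\<close>
definition decodes :: "nat ring \<Rightarrow> nat \<Rightarrow> nat \<Rightarrow> (nat \<Rightarrow> nat \<Rightarrow> nat) \<Rightarrow> nat \<Rightarrow>
    (nat \<Rightarrow> nat \<Rightarrow> nat) \<Rightarrow> nat \<Rightarrow> bool" where
  "decodes Fq L m C r Y d \<longleftrightarrow>
     (\<forall>w w'. is_vec Fq (3*L) w \<longrightarrow> is_vec Fq (3*L) w' \<longrightarrow>
        (\<forall>i<m. lin_row Fq C (3*L) i w = lin_row Fq C (3*L) i w') \<longrightarrow>
        (\<forall>i<r. lin_row Fq Y (3*L) i w = lin_row Fq Y (3*L) i w') \<longrightarrow>
        (\<forall>i<L. w (d*L + i) = w' (d*L + i)))"

definition linear_achievable :: "real \<Rightarrow> real \<Rightarrow> bool" where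
  "linear_achievable M R \<longleftrightarrow>
     (\<exists>(Fq::nat ring) L. field Fq \<and> finite (carrier Fq) \<and> L > 0 \<and>
       (\<exists>(m::nat \<Rightarrow> nat) (C::nat \<Rightarrow> nat \<Rightarrow> nat \<Rightarrow> nat).
          (\<forall>k<3. real (m k) \<le> M * real L \<and> is_mat Fq (m k) (3*L) (C k)) \<and>
          (\<forall>D::nat \<Rightarrow> nat. (\<forall>k<3. D k < 3) \<longrightarrow>
             (\<exists>(r::nat) (Y::nat \<Rightarrow> nat \<Rightarrow> nat). real r \<le> R * real L \<and> is_mat Fq r (3*L) Y \<and>
                (\<forall>k<3. decodes Fq L (m k) (C k) r Y (D k))))))"

definition linear_region :: "(real \<times> real) set" where
  "linear_region = closure {(M, R). linear_achievable M R}"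

definition R_L_star :: "real \<Rightarrow> real" where
  "R_L_star M = Inf {R. (M, R) \<in> linear_region}"

end

theory Submission
  imports Defs "HOL-Combinatorics.Permutations"
begin

text \<open>
  Converse: the kernels of the cache and delivery matrices are subgroups of the finite abelian
  group of all file vectors, and the normalised logarithm of the index of a subgroup plays the
  role of entropy; intersection corresponds to joining variables, and submodularity follows from
  |A B| |A \<inter> B| = |A| |B|.  Linearity enters through the product A B, which realises the common
  information of A and B.  Averaging over all permutations of files and users makes the entropy
  symmetric, after which each bound is a short sum of submodularity instances (their choice is an
  optimal dual solution of the corresponding linear program).

  Achievability: the corner points (0,3), (1/3,2), (1/2,5/3), (3/5,3/2), (1,1), (2,1/3), (3,0) are
  attained by explicit schemes over the field with two elements, whose decodability is checked by
  Gaussian elimination; memory sharing and a limit fill the segments between them.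
\<close>

subsection \<open>Finite abelian groups and symmetrisation\<close>

text \<open>A linear variable is represented by the subgroup of file vectors on which it vanishes:
  knowing more means a smaller subgroup, and decodability becomes an inclusion. With logarithms to
  the base of the number of values of a file, each file has entropy 1. Four of the six bounds are
  sums of submodularity instances alone. The proofs of \<open>bound_10_6\<close> and
  \<open>bound_5_4\<close> also use \<open>H_meet\<close>, where the mutual information of two
  variables is the entropy of a variable determined by each of them. General random variables have
  no such variable, so this is where linear schemes are special. Averaging is built into the
  variables, so symmetry becomes an equation between values of \<open>H\<close>. The corner points
  are the vertices of the upper envelope of the six lines, so the bounds meet the schemes.\<close>

lemma (in group) card_subgroup_Int:
  assumes fin: "finite (carrier G)" and A: "subgroup A G" and B: "subgroup B G"
  shows "card (A <#> B) * card (A \<inter> B) = card A * card B"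
proof -
  have fA: "finite A" and fB: "finite B"
    using fin A B by (meson finite_subset subgroup.subset)+
  let ?f = "\<lambda>(a, b). a \<otimes> b"
  have AB: "A <#> B = ?f ` (A \<times> B)"
    by (auto simp: set_mult_def)
  have fib: "card {x \<in> A \<times> B. ?f x = y} = card (A \<inter> B)" if "y \<in> A <#> B" for y
  proof -
    obtain a b where ab: "a \<in> A" "b \<in> B" "y = a \<otimes> b"
      using \<open>y \<in> A <#> B\<close> by (auto simp: set_mult_def)
    have c: "x \<in> carrier G" if "x \<in> A \<or> x \<in> B" for x
      using that A B by (meson subgroup.mem_carrier)
    \<comment> \<open>One factorisation of \<open>y\<close> yields all others by moving an element
      of \<open>A \<inter> B\<close> across.\<close>
    have "bij_betw (\<lambda>t. (a \<otimes> t, inv t \<otimes> b)) (A \<inter> B) {x \<in> A \<times> B. ?f x = y}"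
    proof (rule bij_betw_imageI)
      show "inj_on (\<lambda>t. (a \<otimes> t, inv t \<otimes> b)) (A \<inter> B)"
        using ab c by (auto simp: inj_on_def)
      show "(\<lambda>t. (a \<otimes> t, inv t \<otimes> b)) ` (A \<inter> B) = {x \<in> A \<times> B. ?f x = y}"
      proof (intro subset_antisym subsetI)
        fix u assume "u \<in> (\<lambda>t. (a \<otimes> t, inv t \<otimes> b)) ` (A \<inter> B)"
        then obtain t where t: "t \<in> A" "t \<in> B" "u = (a \<otimes> t, inv t \<otimes> b)"
          by blast
        moreover have "t \<otimes> (inv t \<otimes> b) = b"
          using t ab c by (simp add: m_assoc[symmetric])
        ultimately show "u \<in> {x \<in> A \<times> B. ?f x = y}"
          using ab c A B by (auto simp: subgroup.m_closed subgroup.m_inv_closed m_assoc)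
      next
        fix u assume "u \<in> {x \<in> A \<times> B. ?f x = y}"
        then obtain a' b' where *: "u = (a', b')" "a' \<in> A" "b' \<in> B" "a' \<otimes> b' = y"
          by auto
        define t where "t = inv a \<otimes> a'"
        have tA: "t \<in> A"
          using * ab A by (simp add: t_def subgroup.m_closed subgroup.m_inv_closed)
        have "a' \<otimes> b' = a \<otimes> b"
          using * ab by simp
        then have t: "t = b \<otimes> inv b'"
          unfolding t_def using * ab c
          by (metis inv_closed inv_solve_left inv_solve_right m_assoc m_closed)
        then have tB: "t \<in> B"
          using * ab B by (simp add: subgroup.m_closed subgroup.m_inv_closed)
        have "a' = a \<otimes> t"
          using * ab c by (simp add: t_def m_assoc[symmetric])
        moreover have "b' = inv t \<otimes> b"
          using t * ab c by (simp add: inv_mult_group m_assoc)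
        ultimately show "u \<in> (\<lambda>t. (a \<otimes> t, inv t \<otimes> b)) ` (A \<inter> B)"
          using tA tB * by blast
      qed
    qed
    then show ?thesis
      by (simp add: bij_betw_same_card)
  qed
  have "card (A \<times> B) = (\<Sum>y\<in>A <#> B. card {x \<in> A \<times> B. ?f x = y})"
    unfolding AB card_eq_sum using fA fB by (rule sum.image_gen[OF finite_cartesian_product])
  then show ?thesis
    using fib by (simp add: card_cartesian_product)
qed

lemma (in comm_group) subgroup_set_mult:
  assumes A: "subgroup A G" and B: "subgroup B G"
  shows "subgroup (A <#> B) G"
proof (rule subgroupI)
  have c: "x \<in> carrier G" if "x \<in> A \<or> x \<in> B" for x
    using that A B by (meson subgroup.mem_carrier)
  show "A <#> B \<subseteq> carrier G"
    using c by (auto simp: set_mult_def)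
  show "A <#> B \<noteq> {}"
    using A B subgroup.one_closed by (fastforce simp: set_mult_def)
  show "inv u \<in> A <#> B" if u: "u \<in> A <#> B" for u
  proof -
    obtain a b where "a \<in> A" "b \<in> B" "u = a \<otimes> b"
      using u by (auto simp: set_mult_def)
    then have "inv u = inv a \<otimes> inv b" "inv a \<in> A" "inv b \<in> B"
      using A B c by (auto simp: inv_mult subgroup.m_inv_closed)
    then show ?thesis
      by (auto simp: set_mult_def)
  qed
  show "u \<otimes> v \<in> A <#> B" if u: "u \<in> A <#> B" and v: "v \<in> A <#> B" for u v
  proof -
    obtain a b a' b' where "a \<in> A" "b \<in> B" "u = a \<otimes> b" "a' \<in> A" "b' \<in> B" "v = a' \<otimes> b'"
      using u v by (auto simp: set_mult_def)
    then have "u \<otimes> v = (a \<otimes> a') \<otimes> (b \<otimes> b')" "a \<otimes> a' \<in> A" "b \<otimes> b' \<in> B"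
      using A B c by (auto simp: m_ac subgroup.m_closed)
    then show ?thesis
      by (auto simp: set_mult_def)
  qed
qed

section \<open>Permutations of files and users\<close>

definition perm3 :: "nat \<Rightarrow> nat \<Rightarrow> nat \<Rightarrow> nat \<Rightarrow> nat" where
  "perm3 a b c = id(0 := a, 1 := b, 2 := c)"

lemma perm3_permutes:
  assumes "{a, b, c} = {0, 1, 2}"
  shows "perm3 a b c permutes {..<3}"
proof (rule bij_imp_permutes)
  have e: "{..<3} = {0, 1, 2::nat}"
    by auto
  have img: "perm3 a b c ` {..<3} = {..<3}"
    using assms unfolding e by (auto simp: perm3_def)
  then show "bij_betw (perm3 a b c) {..<3} {..<3}"
    by (simp add: bij_betw_def eq_card_imp_inj_on)
  show "perm3 a b c x = x" if "x \<notin> {..<3}" for x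
    using that by (auto simp: perm3_def)
qed

lemma perm3_app [simp]: "perm3 a b c 0 = a" "perm3 a b c (Suc 0) = b" "perm3 a b c 2 = c"
  by (simp_all add: perm3_def)

definition demand :: "(nat \<Rightarrow> nat) \<Rightarrow> bool" where
  "demand d \<longleftrightarrow> (\<forall>k<3. d k < 3)"

lemma demand_id [simp]: "demand id"
  by (simp add: demand_def)

lemma demand_perm3 [simp]: "a < 3 \<Longrightarrow> b < 3 \<Longrightarrow> c < 3 \<Longrightarrow> demand (perm3 a b c)"
  by (simp add: demand_def perm3_def)

text \<open>A pair of permutations relabels files by its first and users by its second component; a
  variable of the symmetrised problem is a function from such pairs to subgroups.\<close>

type_synonym perm_pair = "(nat \<Rightarrow> nat) \<times> (nat \<Rightarrow> nat)"

definition perm_pairs :: "perm_pair set" where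
  "perm_pairs = {s. s permutes {..<3}} \<times> {t. t permutes {..<3}}"

text \<open>Right translation on permutation pairs. Averages over \<open>perm_pairs\<close> do not
  see it, while on the variables it renames files by \<open>s\<close> and users by
  \<open>t\<close>.\<close>

definition shift :: "(nat \<Rightarrow> nat) \<Rightarrow> (nat \<Rightarrow> nat) \<Rightarrow> (perm_pair \<Rightarrow> 'b) \<Rightarrow> perm_pair \<Rightarrow> 'b" where
  "shift s t e = (\<lambda>p. e (fst p \<circ> s, snd p \<circ> t))"

lemma card_perm_pairs: "card perm_pairs = 36"
proof -
  have "card {s. s permutes {..<3::nat}} = fact 3"
    by (rule card_permutations) auto
  then show ?thesis
    by (simp add: perm_pairs_def card_cartesian_product fact_numeral)
qed

lemma sum_perm_pairs_shift:
  assumes "s permutes {..<3}" "t permutes {..<3}"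
  shows "(\<Sum>p\<in>perm_pairs. f (fst p \<circ> s, snd p \<circ> t)) = (\<Sum>p\<in>perm_pairs. f p)"
proof (rule sum.reindex_bij_witness[where i = "\<lambda>p. (fst p \<circ> inv_into UNIV s, snd p \<circ> inv_into UNIV t)"
      and j = "\<lambda>p. (fst p \<circ> s, snd p \<circ> t)"])
qed (use assms in \<open>auto simp: perm_pairs_def permutes_compose permutes_inv o_assoc[symmetric]
       permutes_inv_o\<close>)

text \<open>\<open>W n\<close> stands for the file vectors whose file \<open>n\<close> is zero, and
  \<open>N\<close> for the number of values of one file. The cardinalities of the \<open>W n\<close>
  and their intersections say that the files are independent with unit entropy.
  \<open>decode\<close> is zero-error decoding: a vector invisible in cache and message has a zero
  requested file.\<close>

locale group_caching = comm_group G for G (structure) +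
  fixes N :: nat and W Z :: "nat \<Rightarrow> 'a set" and Y :: "(nat \<Rightarrow> nat) \<Rightarrow> 'a set" and M R :: real
  assumes finite_carrier: "finite (carrier G)"
    and N: "N > 1"
    and order_carrier: "card (carrier G) = N ^ 3"
    and subgroup_W: "n < 3 \<Longrightarrow> subgroup (W n) G"
    and subgroup_Z: "k < 3 \<Longrightarrow> subgroup (Z k) G"
    and subgroup_Y: "demand D \<Longrightarrow> subgroup (Y D) G"
    and card_W: "n < 3 \<Longrightarrow> card (W n) = N ^ 2"
    and card_W2: "n < 3 \<Longrightarrow> n' < 3 \<Longrightarrow> n \<noteq> n' \<Longrightarrow> card (W n \<inter> W n') = N"
    and card_W3: "card (W 0 \<inter> W 1 \<inter> W 2) = 1"
    and card_Z: "k < 3 \<Longrightarrow> 3 - log N (card (Z k)) \<le> M"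
    and card_Y: "demand D \<Longrightarrow> 3 - log N (card (Y D)) \<le> R"
    and decode: "demand D \<Longrightarrow> k < 3 \<Longrightarrow> Z k \<inter> Y D \<subseteq> W (D k)"
begin

text \<open>Logarithm to the base \<open>N\<close> of the index of \<open>A\<close>, as the group
  has \<open>N ^ 3\<close> elements.\<close>

definition h :: "'a set \<Rightarrow> real" where
  "h A = 3 - log N (card A)"

lemma subgroup_card_pos: "subgroup A G \<Longrightarrow> card A > 0"
  by (metis card_gt_0_iff empty_iff finite_carrier finite_subset subgroup.one_closed subgroup.subset)

lemma h_antimono:
  assumes "subgroup A G" "subgroup B G" "A \<subseteq> B"
  shows "h B \<le> h A"
proof -
  have "card A \<le> card B"
    using assms by (meson card_mono finite_carrier finite_subset subgroup.subset)
  then show ?thesis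
    using N subgroup_card_pos[OF assms(1)] by (simp add: h_def)
qed

lemma h_set_mult:
  assumes "subgroup A G" "subgroup B G"
  shows "h (A <#> B) + h (A \<inter> B) = h A + h B"
proof -
  have "real (card (A <#> B)) * real (card (A \<inter> B)) = real (card A) * real (card B)"
    using card_subgroup_Int[OF finite_carrier assms] by (metis of_nat_mult)
  then have "log N (real (card (A <#> B)) * real (card (A \<inter> B))) = log N (real (card A) * real (card B))"
    by simp
  then show ?thesis
    using assms N subgroup_card_pos[of A] subgroup_card_pos[of B] subgroup_card_pos[of "A <#> B"]
      subgroup_card_pos[of "A \<inter> B"] subgroup_set_mult[of A B] subgroups_Inter_pair[of A B]
    by (simp add: h_def log_mult)
qed

text \<open>Shaped to absorb decodability: \<open>C\<close> may be any variable that
  \<open>A\<close> and \<open>B\<close> determine together, \<open>D\<close> any variable that each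
  of them determines alone.\<close>

lemma h_submodular:
  assumes "subgroup A G" "subgroup B G" "subgroup C G" "subgroup D G"
    and "A \<inter> B \<subseteq> C" "A \<subseteq> D" "B \<subseteq> D"
  shows "h C + h D \<le> h A + h B"
proof -
  have "A <#> B \<subseteq> D"
    using assms(4,6,7) by (auto simp: set_mult_def subset_iff subgroup.m_closed)
  then have "h D \<le> h (A <#> B)"
    using assms by (intro h_antimono subgroup_set_mult)
  moreover have "h C \<le> h (A \<inter> B)"
    using assms by (intro h_antimono subgroups_Inter_pair)
  ultimately show ?thesis
    using h_set_mult[OF assms(1,2)] by linarith
qed

text \<open>Intersecting with the carrier makes the empty joint variable the whole group, of entropy
  0.\<close>

definition joint :: "(perm_pair \<Rightarrow> 'a set) set \<Rightarrow> perm_pair \<Rightarrow> 'a set" where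
  "joint E p = carrier G \<inter> (\<Inter>e\<in>E. e p)"

definition H :: "(perm_pair \<Rightarrow> 'a set) set \<Rightarrow> real" where
  "H E = (\<Sum>p\<in>perm_pairs. h (joint E p)) / 36"

text \<open>The common information of the joint variables \<open>E\<close> and \<open>F\<close>.\<close>

definition meet :: "(perm_pair \<Rightarrow> 'a set) set \<Rightarrow> (perm_pair \<Rightarrow> 'a set) set \<Rightarrow> perm_pair \<Rightarrow> 'a set" where
  "meet E F = (\<lambda>p. joint E p <#> joint F p)"

definition subgroup_valued :: "(perm_pair \<Rightarrow> 'a set) \<Rightarrow> bool" where
  "subgroup_valued e \<longleftrightarrow> (\<forall>p\<in>perm_pairs. subgroup (e p) G)"

section \<open>Files, caches and messages as symmetrised variables\<close>

definition w :: "nat \<Rightarrow> perm_pair \<Rightarrow> 'a set" where "w n p = W (fst p n)"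
definition z :: "nat \<Rightarrow> perm_pair \<Rightarrow> 'a set" where "z k p = Z (snd p k)"

text \<open>User \<open>snd p k\<close> requests file \<open>fst p (d k)\<close>.  For \<open>snd p\<close> not bijective the inverse is junk; the
  case distinction keeps \<open>shift_y\<close> an equality of functions.\<close>

definition y :: "(nat \<Rightarrow> nat) \<Rightarrow> perm_pair \<Rightarrow> 'a set" where
  "y d p = (if bij (snd p) then Y (fst p \<circ> d \<circ> inv_into UNIV (snd p)) else {})"

lemma perm_app:
  assumes "p \<in> perm_pairs" "i < 3"
  shows "fst p i < 3" "snd p i < 3"
  using assms permutes_in_image[of "fst p" "{..<3}" i] permutes_in_image[of "snd p" "{..<3}" i]
  by (auto simp: perm_pairs_def)

lemma perm_demand:
  assumes "p \<in> perm_pairs" "demand d"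
  shows "demand (fst p \<circ> d \<circ> inv_into UNIV (snd p))"
  unfolding demand_def
proof (intro allI impI)
  fix k :: nat assume "k < 3"
  then have "inv_into UNIV (snd p) k < 3"
    using assms permutes_in_image[OF permutes_inv, of "snd p" "{..<3}" k]
    by (auto simp: perm_pairs_def)
  then show "(fst p \<circ> d \<circ> inv_into UNIV (snd p)) k < 3"
    using assms by (simp add: perm_app demand_def)
qed

lemma y_perm: "p \<in> perm_pairs \<Longrightarrow> y d p = Y (fst p \<circ> d \<circ> inv_into UNIV (snd p))"
  by (auto simp: y_def perm_pairs_def permutes_bij)

lemma subgroup_valued_w: "n < 3 \<Longrightarrow> subgroup_valued (w n)"
  by (simp add: subgroup_valued_def w_def perm_app subgroup_W)

lemma subgroup_valued_z: "k < 3 \<Longrightarrow> subgroup_valued (z k)"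
  by (simp add: subgroup_valued_def z_def perm_app subgroup_Z)

lemma subgroup_valued_y: "demand d \<Longrightarrow> subgroup_valued (y d)"
  unfolding subgroup_valued_def using perm_demand by (auto simp: y_perm intro!: subgroup_Y)

lemma decode_y:
  assumes "p \<in> perm_pairs" "demand d" "k < 3"
  shows "z k p \<inter> y d p \<subseteq> w (d k) p"
proof -
  have "inv_into UNIV (snd p) (snd p k) = k"
    using assms(1) permutes_inverses(2)[of "snd p" "{..<3}"] by (auto simp: perm_pairs_def)
  moreover have "Z (snd p k) \<inter> Y (fst p \<circ> d \<circ> inv_into UNIV (snd p))
      \<subseteq> W ((fst p \<circ> d \<circ> inv_into UNIV (snd p)) (snd p k))"
    by (rule decode[OF perm_demand[OF assms(1,2)] perm_app(2)[OF assms(1,3)]])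
  ultimately show ?thesis
    using assms(1) by (simp add: z_def y_perm w_def)
qed

lemma decode_y_id:
  assumes "p \<in> perm_pairs" "u \<in> y id p"
  shows "u \<in> z 0 p \<Longrightarrow> u \<in> w 0 p" "u \<in> z 1 p \<Longrightarrow> u \<in> w 1 p" "u \<in> z 2 p \<Longrightarrow> u \<in> w 2 p"
  using decode_y[of p id 0] decode_y[of p id 1] decode_y[of p id 2] assms by auto

lemma subgroup_joint:
  assumes "p \<in> perm_pairs" "\<forall>e\<in>E. subgroup_valued e"
  shows "subgroup (joint E p) G"
proof -
  have "joint E p = \<Inter> (insert (carrier G) ((\<lambda>e. e p) ` E))"
    by (simp add: joint_def)
  moreover have "subgroup (\<Inter> (insert (carrier G) ((\<lambda>e. e p) ` E))) G"
    using assms by (intro subgroups_Inter) (auto simp: subgroup_valued_def subgroup_self)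
  ultimately show ?thesis
    by simp
qed

lemma subgroup_valued_meet:
  assumes "\<forall>e\<in>E. subgroup_valued e" "\<forall>e\<in>F. subgroup_valued e"
  shows "subgroup_valued (meet E F)"
  unfolding subgroup_valued_def[of "meet E F"] using assms by (simp add: meet_def subgroup_set_mult subgroup_joint)

text \<open>Smaller subgroups know more, so these inclusions make \<open>meet E F\<close> a function
  of either side.\<close>

lemma joint_subset_meet:
  assumes "p \<in> perm_pairs" "\<forall>e\<in>E. subgroup_valued e" "\<forall>e\<in>F. subgroup_valued e"
  shows "joint E p \<subseteq> meet E F p" "joint F p \<subseteq> meet E F p"
proof -
  have 1: "\<one> \<in> joint E p" "\<one> \<in> joint F p"
    using assms by (auto intro: subgroup.one_closed subgroup_joint)
  have "u = u \<otimes> \<one>" "u = \<one> \<otimes> u" if "u \<in> joint E p \<union> joint F p" for u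
    using that by (auto simp: joint_def)
  with 1 show "joint E p \<subseteq> meet E F p" "joint F p \<subseteq> meet E F p"
    by (fastforce simp: meet_def set_mult_def)+
qed

lemma H_submodular:
  assumes "\<forall>e\<in>A \<union> B \<union> C \<union> D. subgroup_valued e"
    and "\<And>p. p \<in> perm_pairs \<Longrightarrow> joint A p \<inter> joint B p \<subseteq> joint C p"
    and "\<And>p. p \<in> perm_pairs \<Longrightarrow> joint A p \<subseteq> joint D p"
    and "\<And>p. p \<in> perm_pairs \<Longrightarrow> joint B p \<subseteq> joint D p"
  shows "H C + H D \<le> H A + H B"
proof -
  have "(\<Sum>p\<in>perm_pairs. h (joint C p) + h (joint D p)) \<le> (\<Sum>p\<in>perm_pairs. h (joint A p) + h (joint B p))"
    using assms by (intro sum_mono h_submodular) (auto intro: subgroup_joint)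
  then show ?thesis
    by (simp add: H_def sum.distrib add_divide_distrib[symmetric])
qed

lemma H_antimono:
  assumes "\<forall>e\<in>A \<union> B. subgroup_valued e" "\<And>p. p \<in> perm_pairs \<Longrightarrow> joint A p \<subseteq> joint B p"
  shows "H B \<le> H A"
  unfolding H_def using assms
  by (intro divide_right_mono sum_mono h_antimono) (auto intro: subgroup_joint)

lemma H_empty [simp]: "H {} = 0"
  using N by (simp add: H_def joint_def h_def order_carrier log_nat_power)

lemma H_subadditive:
  assumes "\<forall>e\<in>A \<union> B \<union> C. subgroup_valued e"
    and "\<And>p. p \<in> perm_pairs \<Longrightarrow> joint A p \<inter> joint B p \<subseteq> joint C p"
  shows "H C \<le> H A + H B"
  using H_submodular[of A B C "{}"] assms by (auto simp: joint_def)

text \<open>The mutual information of \<open>E\<close> and \<open>F\<close> is the entropy of an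
  actual variable. Shannon inequalities provide no such variable.\<close>

lemma H_meet:
  assumes "\<forall>e\<in>E. subgroup_valued e" "\<forall>e\<in>F. subgroup_valued e"
  shows "H {meet E F} + H (E \<union> F) = H E + H F"
proof -
  have "joint {meet E F} p = joint E p <#> joint F p" if "p \<in> perm_pairs" for p
    using subgroup.subset[OF subgroup_set_mult[OF subgroup_joint[OF that assms(1)] subgroup_joint[OF that assms(2)]]]
    by (auto simp: joint_def[of "{e}" for e] meet_def)
  moreover have "joint (E \<union> F) p = joint E p \<inter> joint F p" for p
    by (auto simp: joint_def)
  ultimately have "(\<Sum>p\<in>perm_pairs. h (joint {meet E F} p) + h (joint (E \<union> F) p)) =
      (\<Sum>p\<in>perm_pairs. h (joint E p) + h (joint F p))"
    using assms by (intro sum.cong) (simp_all add: h_set_mult subgroup_joint)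
  then show ?thesis
    by (simp add: H_def sum.distrib add_divide_distrib[symmetric])
qed

lemma H_shift:
  assumes "s permutes {..<3}" "t permutes {..<3}"
  shows "H (shift s t ` E) = H E"
proof -
  have "joint (shift s t ` E) p = joint E (fst p \<circ> s, snd p \<circ> t)" for p
    by (simp add: joint_def shift_def)
  then show ?thesis
    using sum_perm_pairs_shift[OF assms, of "\<lambda>p. h (joint E p)"] by (simp add: H_def)
qed

lemma shift_w [simp]: "shift s t (w n) = w (s n)"
  by (simp add: shift_def w_def fun_eq_iff)

lemma shift_z [simp]: "shift s t (z k) = z (t k)"
  by (simp add: shift_def z_def fun_eq_iff)

text \<open>After relabelling, user \<open>t k\<close> requests file \<open>s (d k)\<close>; the
  hypothesis says that this is the demand \<open>d'\<close>.\<close>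

lemma shift_y:
  assumes "t permutes {..<3}" "s \<circ> d = d' \<circ> t"
  shows "shift s t (y d) = y d'"
proof
  fix p :: perm_pair
  have t: "bij t" "inv_into UNIV t \<circ> t = id" "t \<circ> inv_into UNIV t = id"
    using assms(1) by (auto simp: permutes_bij permutes_inv_o)
  have "bij (snd p \<circ> t) \<longleftrightarrow> bij (snd p)"
  proof
    assume "bij (snd p \<circ> t)"
    then have "bij (snd p \<circ> t \<circ> inv_into UNIV t)"
      using bij_imp_bij_inv[OF t(1)] by (rule bij_comp[rotated])
    then show "bij (snd p)"
      using t(3) by (simp add: o_assoc[symmetric])
  qed (simp add: t(1) bij_comp)
  moreover have "fst p \<circ> s \<circ> d \<circ> inv_into UNIV (snd p \<circ> t) = fst p \<circ> d' \<circ> inv_into UNIV (snd p)"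
    if "bij (snd p)"
  proof -
    have "fst p \<circ> s \<circ> d \<circ> inv_into UNIV (snd p \<circ> t) = fst p \<circ> (s \<circ> d) \<circ> inv_into UNIV t \<circ> inv_into UNIV (snd p)"
      using t(1) that by (simp add: o_inv_distrib o_assoc)
    also have "\<dots> = fst p \<circ> d' \<circ> (t \<circ> inv_into UNIV t) \<circ> inv_into UNIV (snd p)"
      by (simp only: assms(2) o_assoc)
    finally show ?thesis
      by (simp add: t(3))
  qed
  ultimately show "shift s t (y d) p = y d' p"
    by (simp add: shift_def y_def)
qed

text \<open>Renaming users along with their files fixes the demand with distinct requests, so bounds
  built on \<open>y id\<close> relabel it diagonally.\<close>

lemma shift_y_id: "s permutes {..<3} \<Longrightarrow> shift s s (y id) = y id"
  by (rule shift_y) simp_all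

lemma shift_meet [simp]: "shift s t (meet E F) = meet (shift s t ` E) (shift s t ` F)"
  by (simp add: shift_def meet_def joint_def fun_eq_iff)

lemma H_const:
  assumes "\<And>p. p \<in> perm_pairs \<Longrightarrow> h (joint E p) = c"
  shows "H E = c"
  using assms by (simp add: H_def card_perm_pairs)

lemma H_bound:
  assumes "\<And>p. p \<in> perm_pairs \<Longrightarrow> h (joint E p) \<le> c"
  shows "H E \<le> c"
  using sum_bounded_above[of perm_pairs "\<lambda>p. h (joint E p)" c, OF assms]
  by (simp add: H_def card_perm_pairs)

lemma perm_inj: "p \<in> perm_pairs \<Longrightarrow> fst p n = fst p n' \<longleftrightarrow> n = n'"
  by (auto simp: perm_pairs_def inj_eq dest: permutes_inj)

lemma carrier_Int: "subgroup A G \<Longrightarrow> carrier G \<inter> A = A"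
  by (simp add: Int_absorb1 subgroup.subset)

lemma H_w: "n < 3 \<Longrightarrow> H {w n} = 1"
  by (rule H_const)
    (use N in \<open>simp add: joint_def w_def h_def carrier_Int subgroup_W perm_app card_W log_nat_power\<close>)

lemma H_w2:
  assumes "n < 3" "n' < 3" "n \<noteq> n'"
  shows "H {w n, w n'} = 2"
proof (rule H_const)
  fix p assume p: "p \<in> perm_pairs"
  have "joint {w n, w n'} p = W (fst p n) \<inter> W (fst p n')"
    using subgroup.subset[OF subgroup_W[OF perm_app(1)[OF p assms(1)]]] by (auto simp: joint_def w_def)
  then show "h (joint {w n, w n'} p) = 2"
    using N assms p by (simp add: h_def card_W2 perm_app perm_inj)
qed

lemma H_w3: "H {w 0, w 1, w 2} = 3"
proof (rule H_const)
  fix p assume p: "p \<in> perm_pairs"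
  have e: "{..<3} = {0, 1, 2::nat}"
    by auto
  have "fst p ` {..<3} = {..<3}"
    using p by (intro permutes_image) (auto simp: perm_pairs_def)
  then have "(\<Inter>n\<in>{..<3}. W (fst p n)) = (\<Inter>n\<in>{..<3}. W n)"
    by (metis image_image)
  then have "joint {w 0, w 1, w 2} p = W 0 \<inter> W 1 \<inter> W 2"
    using subgroup.subset[OF subgroup_W[of 0]] by (auto simp: e joint_def w_def)
  then show "h (joint {w 0, w 1, w 2} p) = 3"
    using card_W3 by (simp add: h_def)
qed

lemma H_z: "k < 3 \<Longrightarrow> H {z k} \<le> M"
  by (rule H_bound) (simp add: joint_def z_def h_def carrier_Int subgroup_Z perm_app card_Z)

lemma H_y:
  assumes "demand d"
  shows "H {y d} \<le> R"
proof (rule H_bound)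
  fix p assume p: "p \<in> perm_pairs"
  have "h (Y (fst p \<circ> d \<circ> inv_into UNIV (snd p))) \<le> R"
    unfolding h_def by (rule card_Y[OF perm_demand[OF p assms]])
  moreover have "subgroup (Y (fst p \<circ> d \<circ> inv_into UNIV (snd p))) G"
    by (rule subgroup_Y[OF perm_demand[OF p assms]])
  then have "joint {y d} p = Y (fst p \<circ> d \<circ> inv_into UNIV (snd p))"
    using p by (simp add: joint_def y_perm carrier_Int)
  ultimately show "h (joint {y d} p) \<le> R"
    by simp
qed

subsection \<open>The six bounds\<close>

text \<open>In \<open>r3 + r5\<close> the term \<open>H {w 0, w 2, z 0}\<close> cancels, which
  bounds 8 by \<open>H {w 0, w 1, z 0, z 1} + 2 * H {w 1, z 0, y id}\<close>. By \<open>r2\<close>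
  and \<open>r4\<close> each of these three terms is at most \<open>H {z 0, z 1, y id}\<close>,
  hence at most \<open>2 * M + R\<close>.\<close>

lemma bound_6_3: "8 \<le> 6 * M + 3 * R"
proof -
  have sgs: "\<And>n. n < 3 \<Longrightarrow> subgroup_valued (w n)" "\<And>k. k < 3 \<Longrightarrow> subgroup_valued (z k)" "subgroup_valued (y id)"
    by (simp_all add: subgroup_valued_w subgroup_valued_z subgroup_valued_y)
  note decs = decode_y_id

  have r1: "H {z 0, z 1, y id} \<le> H {z 0, z 1} + H {y id}"
    by (rule H_subadditive) (use decs in \<open>auto simp: sgs joint_def\<close>)
  have r2: "H {w 1, z 0, y id} \<le> H {z 0, z 1, y id}"
    by (rule H_antimono) (use decs in \<open>auto simp: sgs joint_def\<close>)
  have r3: "H {w 0, w 1, w 2} + H {w 0, w 2, z 0} \<le> H {w 0, w 2, z 0, z 1} + H {w 2, z 0, y id}"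
    by (rule H_submodular) (use decs in \<open>auto simp: sgs joint_def\<close>)
  have r4: "H {w 0, w 1, z 0, z 1} \<le> H {z 0, z 1, y id}"
    by (rule H_antimono) (use decs in \<open>auto simp: sgs joint_def\<close>)
  have r5: "H {w 0, w 1, w 2} + H {w 1, w 2} \<le> H {w 1, w 2, z 0} + H {w 2, z 1, y id}"
    by (rule H_submodular) (use decs in \<open>auto simp: sgs joint_def\<close>)
  have r6: "H {z 0, z 1} \<le> H {z 0} + H {z 1}"
    by (rule H_subadditive) (use decs in \<open>auto simp: sgs joint_def\<close>)
  have e1: "H {w 2, z 0, y id} = H {w 1, z 0, y id}"
    using H_shift[of "perm3 0 2 1" "perm3 0 2 1" "{w 1, z 0, y id}"]
    by (simp add: shift_y_id perm3_permutes insert_commute)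
  have e2: "H {w 0, w 1, z 0, z 1} = H {w 0, w 2, z 0, z 1}"
    using H_shift[of "perm3 0 2 1" "perm3 0 1 2" "{w 0, w 2, z 0, z 1}"]
    by (simp add: shift_y_id perm3_permutes insert_commute)
  have e3: "H {w 1, w 2, z 0} = H {w 0, w 2, z 0}"
    using H_shift[of "perm3 1 0 2" "perm3 0 1 2" "{w 0, w 2, z 0}"]
    by (simp add: shift_y_id perm3_permutes insert_commute)
  have e4: "H {w 2, z 1, y id} = H {w 1, z 0, y id}"
    using H_shift[of "perm3 1 2 0" "perm3 1 2 0" "{w 1, z 0, y id}"]
    by (simp add: shift_y_id perm3_permutes insert_commute)
  have e5: "H {z 1} = H {z 0}"
    using H_shift[of "perm3 0 1 2" "perm3 1 0 2" "{z 0}"]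
    by (simp add: shift_y_id perm3_permutes insert_commute)
  show ?thesis
    using r1 r2 r3 r4 r5 r6 e1 e2 e3 e4 e5
      H_w[of 0] H_w[of 1] H_w[of 2] H_w2[of 0 1] H_w2[of 1 2] H_w3 H_z[of 0] H_y[of id]
    by simp
qed

text \<open>\<open>a\<close> is the information shared by file 1 and the message. Adding
  \<open>r2\<close>, \<open>r5\<close>, \<open>r7\<close>, \<open>r8\<close> and \<open>r10\<close>
  leaves \<open>H {w 0, a} + H {a}\<close> on the lower side; \<open>r3\<close> replaces it by
  \<open>1 + 2 * H {a}\<close>, and \<open>m1\<close> exchanges \<open>H {a}\<close> for
  \<open>1 + H {y id} - H {w 1, y id}\<close>. Three copies of \<open>r9\<close> cancel
  \<open>H {w 1, z 0, y id}\<close> and \<open>H {w 1, w 2, z 0}\<close>; \<open>r1\<close>,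
  \<open>r4\<close>, \<open>r6\<close> and \<open>r11\<close> bound the rest.\<close>

lemma bound_10_6: "15 \<le> 10 * M + 6 * R"
proof -
  define a where "a = meet {w 1} {y id}"
  have sgs: "subgroup_valued a" "\<And>n. n < 3 \<Longrightarrow> subgroup_valued (w n)" "\<And>k. k < 3 \<Longrightarrow> subgroup_valued (z k)" "subgroup_valued (y id)"
    by (simp_all add: a_def subgroup_valued_meet subgroup_valued_w subgroup_valued_z subgroup_valued_y)
  have ab: "u \<in> a p" if "p \<in> perm_pairs" "u \<in> carrier G" "u \<in> w 1 p \<or> u \<in> y id p" for u p
    using that joint_subset_meet[of p "{w 1}" "{y id}"] sgs by (auto simp: a_def joint_def)
  note decs = decode_y_id ab
  have m1: "H {a} + H {w 1, y id} = H {w 1} + H {y id}"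
    using H_meet[of "{w 1}" "{y id}"] sgs by (simp add: a_def insert_commute)

  have r1: "H {z 0, y id} \<le> H {z 0} + H {y id}"
    by (rule H_subadditive) (use decs in \<open>auto simp: sgs joint_def\<close>)
  have r2: "H {w 0, w 1, w 2} + H {w 2, z 0, a} \<le> H {w 0, w 2, z 0, a} + H {w 1, w 2, z 0}"
    by (rule H_submodular) (use decs in \<open>auto simp: sgs joint_def\<close>)
  have r3: "H {w 0, w 1} + H {a} \<le> H {w 0, a} + H {w 1}"
    by (rule H_submodular) (use decs in \<open>auto simp: sgs joint_def\<close>)
  have r4: "H {w 0, y id} \<le> H {z 0, y id}"
    by (rule H_antimono) (use decs in \<open>auto simp: sgs joint_def\<close>)
  have r5: "H {w 2, z 0, y id} + H {w 2, a} \<le> H {w 2, z 0, a} + H {w 2, y id}"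
    by (rule H_submodular) (use decs in \<open>auto simp: sgs joint_def\<close>)
  have r6: "H {w 0, w 1, z 0, z 1} \<le> H {z 0, z 1, y id}"
    by (rule H_antimono) (use decs in \<open>auto simp: sgs joint_def\<close>)
  have r7: "H {w 0, w 2, z 0, a} + H {w 0, z 0} \<le> H {w 0, w 2, z 0} + H {w 0, z 0, a}"
    by (rule H_submodular) (use decs in \<open>auto simp: sgs joint_def\<close>)
  have r8: "H {w 1, z 0, y id} + H {a} \<le> H {w 1, z 0} + H {y id}"
    by (rule H_submodular) (use decs in \<open>auto simp: sgs joint_def\<close>)
  have r9: "H {w 0, w 1, w 2} + H {w 0, w 2, z 0} \<le> H {w 0, w 2, z 0, z 1} + H {w 2, z 0, y id}"
    by (rule H_submodular) (use decs in \<open>auto simp: sgs joint_def\<close>)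
  have r10: "H {w 1, z 0, y id} + H {w 0, z 0, a} \<le> H {w 0, w 1, z 0} + H {z 0, y id}"
    by (rule H_submodular) (use decs in \<open>auto simp: sgs joint_def\<close>)
  have r11: "H {z 0, z 1, y id} \<le> H {z 0} + H {z 1, y id}"
    by (rule H_subadditive) (use decs in \<open>auto simp: sgs joint_def\<close>)
  have e1: "H {w 2, y id} = H {w 0, y id}"
    using H_shift[of "perm3 2 0 1" "perm3 2 0 1" "{w 0, y id}"]
    by (simp add: shift_y_id perm3_permutes insert_commute)
  have e2: "H {w 2, a} = H {w 0, a}"
    using H_shift[of "perm3 2 1 0" "perm3 2 1 0" "{w 0, a}"]
    by (simp add: shift_y_id perm3_permutes insert_commute a_def)
  have e3: "H {w 0, w 2, z 0} = H {w 1, w 2, z 0}"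
    using H_shift[of "perm3 1 0 2" "perm3 0 1 2" "{w 1, w 2, z 0}"]
    by (simp add: shift_y_id perm3_permutes insert_commute)
  have e4: "H {w 1, z 0} = H {w 0, z 0}"
    using H_shift[of "perm3 1 0 2" "perm3 0 1 2" "{w 0, z 0}"]
    by (simp add: shift_y_id perm3_permutes insert_commute)
  have e5: "H {w 1, z 0, y id} = H {w 2, z 0, y id}"
    using H_shift[of "perm3 0 2 1" "perm3 0 2 1" "{w 2, z 0, y id}"]
    by (simp add: shift_y_id perm3_permutes insert_commute)
  have e6: "H {w 0, w 2, z 0, z 1} = H {w 0, w 1, z 0, z 1}"
    using H_shift[of "perm3 0 2 1" "perm3 0 1 2" "{w 0, w 1, z 0, z 1}"]
    by (simp add: shift_y_id perm3_permutes insert_commute)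
  have e7: "H {w 0, w 1, z 0} = H {w 1, w 2, z 0}"
    using H_shift[of "perm3 2 0 1" "perm3 0 1 2" "{w 1, w 2, z 0}"]
    by (simp add: shift_y_id perm3_permutes insert_commute)
  have e8: "H {z 1, y id} = H {z 0, y id}"
    using H_shift[of "perm3 1 0 2" "perm3 1 0 2" "{z 0, y id}"]
    by (simp add: shift_y_id perm3_permutes insert_commute)
  have e9: "H {w 1, y id} = H {w 0, y id}"
    using H_shift[of "perm3 1 0 2" "perm3 1 0 2" "{w 0, y id}"]
    by (simp add: shift_y_id perm3_permutes insert_commute)
  show ?thesis
    using m1 r1 r2 r3 r4 r5 r6 r7 r8 r9 r10 r11 e1 e2 e3 e4 e5 e6 e7 e8 e9
      H_w[of 0] H_w[of 1] H_w[of 2] H_w2[of 0 1] H_w2[of 1 2] H_w3 H_z[of 0] H_y[of id]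
    by simp
qed

text \<open>The meets are chosen so that \<open>{z 1, y id}\<close> and \<open>{z 2, y id}\<close>
  each determine both \<open>a\<close> and \<open>b\<close>, as \<open>r4\<close> exploits. Together
  \<open>m1\<close> and \<open>m2\<close> give
  \<open>H {a} + H {b} + H {w 1, w 2, z 1} = 2 + H {z 2}\<close>, and these three entropies arise on
  the lower side when \<open>r1\<close>, \<open>r2\<close>, \<open>r6\<close>, \<open>r7\<close> and
  \<open>r8\<close> are added. The rest takes \<open>r4\<close>, \<open>r5\<close>,
  \<open>r9\<close> twice and \<open>r3\<close> four times.\<close>

lemma bound_5_4: "9 \<le> 5 * M + 4 * R"
proof -
  define a where "a = meet {w 1} {z 2}"
  define b where "b = meet {w 2} {w 1, z 1}"
  have sgs: "subgroup_valued a" "subgroup_valued b" "\<And>n. n < 3 \<Longrightarrow> subgroup_valued (w n)" "\<And>k. k < 3 \<Longrightarrow> subgroup_valued (z k)" "subgroup_valued (y id)"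
    by (simp_all add: a_def b_def subgroup_valued_meet subgroup_valued_w subgroup_valued_z subgroup_valued_y)
  have ab: "u \<in> a p" if "p \<in> perm_pairs" "u \<in> carrier G" "u \<in> w 1 p \<or> u \<in> z 2 p" for u p
    using that joint_subset_meet[of p "{w 1}" "{z 2}"] sgs by (auto simp: a_def joint_def)
  have bb: "u \<in> b p" if "p \<in> perm_pairs" "u \<in> carrier G" "u \<in> w 2 p \<or> u \<in> w 1 p \<and> u \<in> z 1 p" for u p
    using that joint_subset_meet[of p "{w 2}" "{w 1, z 1}"] sgs by (auto simp: b_def joint_def)
  note decs = decode_y_id ab bb
  have m1: "H {a} + H {w 1, z 2} = H {w 1} + H {z 2}"
    using H_meet[of "{w 1}" "{z 2}"] sgs by (simp add: a_def insert_commute)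
  have m2: "H {b} + H {w 1, w 2, z 1} = H {w 2} + H {w 1, z 1}"
    using H_meet[of "{w 2}" "{w 1, z 1}"] sgs by (simp add: b_def insert_commute)

  have r1: "H {w 0, w 1, w 2} + H {a} \<le> H {w 1} + H {w 0, w 2, a}"
    by (rule H_submodular) (use decs in \<open>auto simp: sgs joint_def\<close>)
  have r2: "H {z 0, z 2, y id} + H {w 0, b, a} \<le> H {w 0, z 2, b} + H {z 0, y id, b, a}"
    by (rule H_submodular) (use decs in \<open>auto simp: sgs joint_def\<close>)
  have r3: "H {z 0, y id} \<le> H {z 0} + H {y id}"
    by (rule H_subadditive) (use decs in \<open>auto simp: sgs joint_def\<close>)
  have r4: "H {z 1, z 2, y id} + H {y id, b, a} \<le> H {z 1, y id} + H {z 2, y id}"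
    by (rule H_submodular) (use decs in \<open>auto simp: sgs joint_def\<close>)
  have r5: "H {w 0, w 1, z 0, z 1} \<le> H {z 0, z 1, y id}"
    by (rule H_antimono) (use decs in \<open>auto simp: sgs joint_def\<close>)
  have r6: "H {w 0, w 1, w 2} + H {w 0, w 2, z 0} \<le> H {w 0, w 2, z 0, z 1} + H {z 0, z 2, y id}"
    by (rule H_submodular) (use decs in \<open>auto simp: sgs joint_def\<close>)
  have r7: "H {w 0, w 2, a} + H {b} \<le> H {w 2} + H {w 0, b, a}"
    by (rule H_submodular) (use decs in \<open>auto simp: sgs joint_def\<close>)
  have r8: "H {w 0, w 1, w 2} + H {w 0, z 0, b} \<le> H {w 0, w 2, z 0, z 1} + H {z 0, y id, b, a}"
    by (rule H_submodular) (use decs in \<open>auto simp: sgs joint_def\<close>)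
  have r9: "H {z 0, y id, b, a} \<le> H {z 0} + H {y id, b, a}"
    by (rule H_subadditive) (use decs in \<open>auto simp: sgs joint_def\<close>)
  have e1: "H {z 1, y id} = H {z 0, y id}"
    using H_shift[of "perm3 1 0 2" "perm3 1 0 2" "{z 0, y id}"]
    by (simp add: shift_y_id perm3_permutes insert_commute)
  have e2: "H {z 2, y id} = H {z 0, y id}"
    using H_shift[of "perm3 2 0 1" "perm3 2 0 1" "{z 0, y id}"]
    by (simp add: shift_y_id perm3_permutes insert_commute)
  have e3: "H {z 1, z 2, y id} = H {z 0, z 2, y id}"
    using H_shift[of "perm3 1 0 2" "perm3 1 0 2" "{z 0, z 2, y id}"]
    by (simp add: shift_y_id perm3_permutes insert_commute)
  have e4: "H {z 0, z 1, y id} = H {z 0, z 2, y id}"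
    using H_shift[of "perm3 0 2 1" "perm3 0 2 1" "{z 0, z 2, y id}"]
    by (simp add: shift_y_id perm3_permutes insert_commute)
  have e5: "H {w 0, w 2, z 0, z 1} = H {w 0, w 1, z 0, z 1}"
    using H_shift[of "perm3 0 2 1" "perm3 0 1 2" "{w 0, w 1, z 0, z 1}"]
    by (simp add: shift_y_id perm3_permutes insert_commute)
  have e6: "H {w 2} = H {w 1}"
    using H_shift[of "perm3 0 2 1" "perm3 0 1 2" "{w 1}"]
    by (simp add: shift_y_id perm3_permutes insert_commute)
  have e7: "H {w 0, z 0, b} = H {w 0, z 2, b}"
    using H_shift[of "perm3 0 1 2" "perm3 2 1 0" "{w 0, z 2, b}"]
    by (simp add: shift_y_id perm3_permutes insert_commute b_def)
  have e8: "H {w 1, z 1} = H {w 1, z 2}"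
    using H_shift[of "perm3 0 1 2" "perm3 0 2 1" "{w 1, z 2}"]
    by (simp add: shift_y_id perm3_permutes insert_commute)
  have e9: "H {w 1, w 2, z 1} = H {w 0, w 2, z 0}"
    using H_shift[of "perm3 1 0 2" "perm3 1 0 2" "{w 0, w 2, z 0}"]
    by (simp add: shift_y_id perm3_permutes insert_commute)
  have e10: "H {z 2} = H {z 0}"
    using H_shift[of "perm3 0 1 2" "perm3 2 1 0" "{z 0}"]
    by (simp add: shift_y_id perm3_permutes insert_commute)
  show ?thesis
    using m1 m2 r1 r2 r3 r4 r5 r6 r7 r8 r9 e1 e2 e3 e4 e5 e6 e7 e8 e9 e10
      H_w[of 0] H_w[of 1] H_w[of 2] H_w2[of 0 1] H_w2[of 1 2] H_w3 H_z[of 0] H_y[of id]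
    by simp
qed

text \<open>With \<open>r6\<close> taken twice and \<open>r2\<close> five times, the inequalities
  add up to twice the bound. Users 0 and 1 share a request in every demand used; exchanging them
  fixes the messages in \<open>e8\<close>.\<close>

lemma bound_2_3: "5 \<le> 2 * M + 3 * R"
proof -
  have dec: "u \<in> w (perm3 i j l k) p"
    if "p \<in> perm_pairs" "u \<in> z k p" "u \<in> y (perm3 i j l) p" "k < 3" "i < 3" "j < 3" "l < 3" for u k p i j l
    using decode_y[of p "perm3 i j l" k] that by auto
  note dec3 = dec[of _ _ 0] dec[of _ _ 1] dec[of _ _ 2]
  note decs = dec3[of _ _ 0 0 1] dec3[of _ _ 1 1 0] dec3[of _ _ 1 1 2]
  have sgs: "\<And>n. n < 3 \<Longrightarrow> subgroup_valued (w n)" "\<And>k. k < 3 \<Longrightarrow> subgroup_valued (z k)"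
      "\<And>i j k. i < 3 \<Longrightarrow> j < 3 \<Longrightarrow> k < 3 \<Longrightarrow> subgroup_valued (y (perm3 i j k))"
    by (simp_all add: subgroup_valued_w subgroup_valued_z subgroup_valued_y)
  have cases3: "l = 0 \<or> l = 1 \<or> l = 2 \<or> l \<ge> 3" for l :: nat
    by auto
  \<comment> \<open>\<open>perm3\<close> is the identity above 2, so demands can be compared as
    total functions, as \<open>shift_y\<close> requires.\<close>
  have perm3_ge: "perm3 i j k l = l" if "l \<ge> 3" for i j k l
    using that by (simp add: perm3_def)
  have shift_id: "shift s (perm3 0 (Suc 0) 2) (y (perm3 i j k)) = y (perm3 (s i) (s j) (s k))"
    if "s permutes {..<3}" for s i j k
  proof (intro shift_y perm3_permutes ext)
    fix l show "(s \<circ> perm3 i j k) l = (perm3 (s i) (s j) (s k) \<circ> perm3 0 (Suc 0) 2) l"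
      using cases3[of l] permutes_not_in[OF that, of l] by (auto simp: perm3_ge)
  qed simp
  have shift_swap: "shift (perm3 0 (Suc 0) 2) (perm3 (Suc 0) 0 2) (y (perm3 (Suc 0) (Suc 0) c)) =
      y (perm3 (Suc 0) (Suc 0) c)" if "c < 3" for c
  proof (intro shift_y perm3_permutes ext)
    fix l show "(perm3 0 (Suc 0) 2 \<circ> perm3 (Suc 0) (Suc 0) c) l = (perm3 (Suc 0) (Suc 0) c \<circ> perm3 (Suc 0) 0 2) l"
      using cases3[of l] cases3[of c] that by (auto simp: perm3_ge)
  qed auto

  have r1: "H {w 0, z 0, y (perm3 1 1 2)} \<le> H {w 0, z 0} + H {y (perm3 1 1 2)}"
    by (rule H_subadditive) (use decs in \<open>auto simp: sgs joint_def\<close>)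
  have r2: "H {z 0, y (perm3 0 0 1)} \<le> H {z 0} + H {y (perm3 0 0 1)}"
    by (rule H_subadditive) (use decs in \<open>auto simp: sgs joint_def\<close>)
  have r3: "H {w 0, w 1, w 2} + H {z 0} \<le> H {w 0, z 0} + H {w 1, w 2, z 0}"
    by (rule H_submodular) (use decs in \<open>auto simp: sgs joint_def\<close>)
  have r4: "H {w 1, z 0, z 1} \<le> H {z 0, z 1, y (perm3 1 1 0), y (perm3 1 1 2)}"
    by (rule H_antimono) (use decs in \<open>auto simp: sgs joint_def\<close>)
  have r5: "H {z 0, z 2, y (perm3 0 0 1)} + H {w 0, z 0}
      \<le> H {w 0, z 0, z 2} + H {z 0, y (perm3 0 0 1)}"
    by (rule H_submodular) (use decs in \<open>auto simp: sgs joint_def\<close>)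
  have r6: "H {z 0, y (perm3 1 1 0), y (perm3 1 1 2)} + H {w 1, z 0}
      \<le> H {z 0, y (perm3 1 1 2)} + H {z 0, y (perm3 1 1 0)}"
    by (rule H_submodular) (use decs in \<open>auto simp: sgs joint_def\<close>)
  have r7: "H {w 0, w 1, w 2} + H {w 1}
      \<le> H {w 1, z 2} + H {w 1, y (perm3 1 1 0), y (perm3 1 1 2)}"
    by (rule H_submodular) (use decs in \<open>auto simp: sgs joint_def\<close>)
  have r8: "H {w 0, w 1, w 2} + H {w 0, w 1, z 0}
      \<le> H {z 0, z 2, y (perm3 0 0 1)} + H {w 0, z 0, y (perm3 1 1 2)}"
    by (rule H_submodular) (use decs in \<open>auto simp: sgs joint_def\<close>)
  have r9: "H {z 0, z 1, y (perm3 1 1 0), y (perm3 1 1 2)} + H {w 1, y (perm3 1 1 0), y (perm3 1 1 2)}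
      \<le> H {z 0, y (perm3 1 1 0), y (perm3 1 1 2)} + H {z 1, y (perm3 1 1 0), y (perm3 1 1 2)}"
    by (rule H_submodular) (use decs in \<open>auto simp: sgs joint_def\<close>)
  have e1: "H {y (perm3 0 0 1)} = H {y (perm3 1 1 2)}"
    using H_shift[of "perm3 2 0 1" "perm3 0 1 2" "{y (perm3 1 1 2)}"]
    by (simp add: shift_swap shift_id perm3_permutes insert_commute)
  have e2: "H {w 0, z 0, z 2} = H {w 1, z 0, z 1}"
    using H_shift[of "perm3 1 0 2" "perm3 0 2 1" "{w 1, z 0, z 1}"]
    by (simp add: shift_swap shift_id perm3_permutes insert_commute)
  have e3: "H {z 0, y (perm3 1 1 2)} = H {z 0, y (perm3 0 0 1)}"
    using H_shift[of "perm3 1 2 0" "perm3 0 1 2" "{z 0, y (perm3 0 0 1)}"]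
    by (simp add: shift_swap shift_id perm3_permutes insert_commute)
  have e4: "H {z 0, y (perm3 1 1 0)} = H {z 0, y (perm3 0 0 1)}"
    using H_shift[of "perm3 1 0 2" "perm3 0 1 2" "{z 0, y (perm3 0 0 1)}"]
    by (simp add: shift_swap shift_id perm3_permutes insert_commute)
  have e5: "H {w 1, z 0} = H {w 0, z 0}"
    using H_shift[of "perm3 1 0 2" "perm3 0 1 2" "{w 0, z 0}"]
    by (simp add: shift_swap shift_id perm3_permutes insert_commute)
  have e6: "H {w 1, z 2} = H {w 0, z 0}"
    using H_shift[of "perm3 1 0 2" "perm3 2 0 1" "{w 0, z 0}"]
    by (simp add: shift_swap shift_id perm3_permutes insert_commute)
  have e7: "H {w 0, w 1, z 0} = H {w 1, w 2, z 0}"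
    using H_shift[of "perm3 2 0 1" "perm3 0 1 2" "{w 1, w 2, z 0}"]
    by (simp add: shift_swap shift_id perm3_permutes insert_commute)
  have e8: "H {z 1, y (perm3 1 1 0), y (perm3 1 1 2)} = H {z 0, y (perm3 1 1 0), y (perm3 1 1 2)}"
    using H_shift[of "perm3 0 1 2" "perm3 1 0 2" "{z 0, y (perm3 1 1 0), y (perm3 1 1 2)}"]
    by (simp add: shift_swap shift_id perm3_permutes insert_commute)
  show ?thesis
    using r1 r2 r3 r4 r5 r6 r7 r8 r9 e1 e2 e3 e4 e5 e6 e7 e8
      H_w[of 0] H_w[of 1] H_w[of 2] H_w2[of 0 1] H_w2[of 1 2] H_w3 H_z[of 0] H_y[of "perm3 0 0 1"]
    by simp
qed

lemma bound_cutset_M: "3 \<le> 3 * M + R"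
proof -
  note decs = decode_y_id
  have sgs: "\<And>n. n < 3 \<Longrightarrow> subgroup_valued (w n)" "\<And>k. k < 3 \<Longrightarrow> subgroup_valued (z k)" "subgroup_valued (y id)"
    by (simp_all add: subgroup_valued_w subgroup_valued_z subgroup_valued_y)
  have "H {w 0, w 1, w 2} \<le> H {z 0, z 1} + H {z 2, y id}"
    by (rule H_subadditive) (use decs in \<open>auto simp: sgs joint_def\<close>)
  moreover have "H {z 0, z 1} \<le> H {z 0} + H {z 1}"
    by (rule H_subadditive) (auto simp: sgs joint_def)
  moreover have "H {z 2, y id} \<le> H {z 2} + H {y id}"
    by (rule H_subadditive) (auto simp: sgs joint_def)
  ultimately show ?thesis
    using H_w3 H_z[of 0] H_z[of 1] H_z[of 2] H_y[of id] by simp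
qed

text \<open>One cache and three messages, in which user 0 requests each file in turn, determine all
  files.\<close>

lemma bound_cutset_R: "3 \<le> M + 3 * R"
proof -
  have dec: "u \<in> w i p"
    if "p \<in> perm_pairs" "u \<in> z 0 p" "u \<in> y (perm3 i j l) p" "i < 3" "j < 3" "l < 3" for u p i j l
    using decode_y[of p "perm3 i j l" 0] that by auto
  note decs = dec[of _ _ 0 0 0] dec[of _ _ 1 0 0] dec[of _ _ 2 0 0]
  have sgs: "\<And>n. n < 3 \<Longrightarrow> subgroup_valued (w n)" "\<And>k. k < 3 \<Longrightarrow> subgroup_valued (z k)"
      "\<And>i j k. i < 3 \<Longrightarrow> j < 3 \<Longrightarrow> k < 3 \<Longrightarrow> subgroup_valued (y (perm3 i j k))"
    by (simp_all add: subgroup_valued_w subgroup_valued_z subgroup_valued_y)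
  have "H {w 0, w 1, w 2} \<le> H {z 0, y (perm3 0 0 0)} + H {y (perm3 1 0 0), y (perm3 2 0 0)}"
    by (rule H_subadditive) (use decs in \<open>auto simp: sgs joint_def\<close>)
  moreover have "H {z 0, y (perm3 0 0 0)} \<le> H {z 0} + H {y (perm3 0 0 0)}"
    by (rule H_subadditive) (auto simp: sgs joint_def)
  moreover have "H {y (perm3 1 0 0), y (perm3 2 0 0)} \<le> H {y (perm3 1 0 0)} + H {y (perm3 2 0 0)}"
    by (rule H_subadditive) (auto simp: sgs joint_def)
  ultimately show ?thesis
    using H_w3 H_z[of 0] H_y[of "perm3 0 0 0"] H_y[of "perm3 1 0 0"] H_y[of "perm3 2 0 0"]
    by simp
qed

end

subsection \<open>From linear schemes to groups\<close>

locale linear_code = field Fq for Fq :: "nat ring" (structure) +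
  fixes n :: nat
  assumes finite_carrier: "finite (carrier Fq)"
begin

definition V :: "(nat \<Rightarrow> nat) monoid" where
  "V = product_group {..<n} (\<lambda>_. add_monoid Fq)"

definition ker :: "nat \<Rightarrow> (nat \<Rightarrow> nat \<Rightarrow> nat) \<Rightarrow> (nat \<Rightarrow> nat) set" where
  "ker r A = {v \<in> carrier V. \<forall>i<r. lin_row Fq A n i v = \<zero>}"

lemma carrier_V: "carrier V = ({..<n} \<rightarrow>\<^sub>E carrier Fq)"
  by (simp add: V_def)

lemma one_V: "j < n \<Longrightarrow> \<one>\<^bsub>V\<^esub> j = \<zero>"
  by (simp add: V_def)

lemma mult_V: "j < n \<Longrightarrow> (v \<otimes>\<^bsub>V\<^esub> v') j = v j \<oplus> v' j"
  by (simp add: V_def)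

lemma comm_group_V: "comm_group V"
proof (rule group.group_comm_groupI)
  show "group V"
    unfolding V_def using a_group by simp
  show "v \<otimes>\<^bsub>V\<^esub> v' = v' \<otimes>\<^bsub>V\<^esub> v" if "v \<in> carrier V" "v' \<in> carrier V" for v v'
    using that by (auto simp: V_def PiE_iff restrict_def fun_eq_iff a_comm)
qed

lemma finite_V: "finite (carrier V)"
  by (simp add: carrier_V finite_PiE finite_carrier)

lemma card_V: "card (carrier V) = card (carrier Fq) ^ n"
  by (simp add: carrier_V card_PiE)

lemma card_carrier_gt_1: "card (carrier Fq) > 1"
proof -
  have "card {\<zero>, \<one>} \<le> card (carrier Fq)"
    by (rule card_mono) (auto simp: finite_carrier)
  then show ?thesis
    by simp
qed

lemma lin_row_closed:
  assumes "is_mat Fq r n A" "i < r" "v \<in> carrier V"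
  shows "lin_row Fq A n i v \<in> carrier Fq"
  unfolding lin_row_def using assms by (intro finsum_closed) (auto simp: is_mat_def carrier_V)

lemma lin_row_mult:
  assumes "is_mat Fq r n A" "i < r" "v \<in> carrier V" "v' \<in> carrier V"
  shows "lin_row Fq A n i (v \<otimes>\<^bsub>V\<^esub> v') = lin_row Fq A n i v \<oplus> lin_row Fq A n i v'"
proof -
  have c: "A i j \<in> carrier Fq" "v j \<in> carrier Fq" "v' j \<in> carrier Fq" if "j < n" for j
    using assms that by (auto simp: is_mat_def carrier_V)
  have "lin_row Fq A n i (v \<otimes>\<^bsub>V\<^esub> v') = (\<Oplus>j\<in>{..<n}. A i j \<otimes> v j \<oplus> A i j \<otimes> v' j)"
    unfolding lin_row_def using c by (intro finsum_cong') (auto simp: mult_V r_distr)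
  also have "\<dots> = lin_row Fq A n i v \<oplus> lin_row Fq A n i v'"
    unfolding lin_row_def using c by (intro finsum_addf) auto
  finally show ?thesis .
qed

lemma lin_row_one:
  assumes "is_mat Fq r n A" "i < r"
  shows "lin_row Fq A n i \<one>\<^bsub>V\<^esub> = \<zero>"
proof -
  have "lin_row Fq A n i \<one>\<^bsub>V\<^esub> = (\<Oplus>j\<in>{..<n}. \<zero>)"
    unfolding lin_row_def using assms by (intro finsum_cong') (auto simp: one_V is_mat_def)
  then show ?thesis
    by simp
qed

lemma lin_row_inv:
  assumes "is_mat Fq r n A" "i < r" "v \<in> carrier V"
  shows "lin_row Fq A n i (inv\<^bsub>V\<^esub> v) = \<ominus> lin_row Fq A n i v"
proof -
  interpret V: comm_group V
    by (rule comm_group_V)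
  have "lin_row Fq A n i v \<oplus> lin_row Fq A n i (inv\<^bsub>V\<^esub> v) = \<zero>"
    using lin_row_mult[OF assms V.inv_closed[OF assms(3)]] lin_row_one[OF assms(1,2)] assms(3) by simp
  then show ?thesis
    using lin_row_closed[OF assms(1,2)] assms(3) by (metis V.inv_closed a_comm minus_equality)
qed

lemma subgroup_ker:
  assumes "is_mat Fq r n A"
  shows "subgroup (ker r A) V"
proof -
  interpret V: comm_group V
    by (rule comm_group_V)
  show ?thesis
  proof (rule V.subgroupI)
    show "ker r A \<noteq> {}"
      using lin_row_one[OF assms] V.one_closed unfolding ker_def by blast
  qed (auto simp: ker_def lin_row_mult[OF assms] lin_row_inv[OF assms])
qed

text \<open>Rank at most \<open>r\<close>, in counting form: a fibre of the map given by the rows is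
  empty or a coset of the kernel, and the map has at most \<open>card (carrier Fq) ^ r\<close>
  values.\<close>

lemma card_ker:
  assumes "is_mat Fq r n A"
  shows "card (carrier Fq) ^ n \<le> card (ker r A) * card (carrier Fq) ^ r"
proof -
  interpret V: comm_group V
    by (rule comm_group_V)
  let ?f = "\<lambda>v. \<lambda>i\<in>{..<r}. lin_row Fq A n i v"
  let ?T = "{..<r} \<rightarrow>\<^sub>E carrier Fq"
  have fT: "finite ?T"
    by (simp add: finite_PiE finite_carrier)
  have fib: "card {v \<in> carrier V. ?f v = t} \<le> card (ker r A)" for t
  proof (cases "{v \<in> carrier V. ?f v = t} = {}")
    case False
    then obtain u where u: "u \<in> carrier V" "?f u = t"
      by blast
    show ?thesis
    proof (rule card_inj_on_le)
      show "inj_on (\<lambda>v. v \<otimes>\<^bsub>V\<^esub> inv\<^bsub>V\<^esub> u) {v \<in> carrier V. ?f v = t}"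
        using u by (auto simp: inj_on_def)
      show "finite (ker r A)"
        using finite_V by (auto simp: ker_def)
      have "lin_row Fq A n i (v \<otimes>\<^bsub>V\<^esub> inv\<^bsub>V\<^esub> u) = \<zero>" if "v \<in> carrier V" "?f v = t" "i < r" for v i
      proof -
        have "lin_row Fq A n i v = lin_row Fq A n i u"
          using that u by (metis lessThan_iff restrict_apply')
        then show ?thesis
          using that u lin_row_closed[OF assms \<open>i < r\<close>]
          by (simp add: lin_row_mult[OF assms] lin_row_inv[OF assms] r_neg)
      qed
      then show "(\<lambda>v. v \<otimes>\<^bsub>V\<^esub> inv\<^bsub>V\<^esub> u) ` {v \<in> carrier V. ?f v = t} \<subseteq> ker r A"
        using u by (auto simp: ker_def)
    qed
  next
    case True
    then show ?thesis
      by (simp only: card.empty)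
  qed
  have "card (carrier V) = (\<Sum>t\<in>?f ` carrier V. card {v \<in> carrier V. ?f v = t})"
    unfolding card_eq_sum by (rule sum.image_gen[OF finite_V])
  also have "\<dots> \<le> (\<Sum>t\<in>?f ` carrier V. card (ker r A))"
    by (rule sum_mono) (rule fib)
  also have "\<dots> \<le> card (ker r A) * card ?T"
  proof -
    have "?f ` carrier V \<subseteq> ?T"
      by (intro image_subsetI restrict_PiE_iff[THEN iffD2] ballI lin_row_closed[OF assms]) auto
    then have "card (?f ` carrier V) \<le> card ?T"
      by (rule card_mono[OF fT])
    then show ?thesis
      by simp
  qed
  finally show ?thesis
    by (simp add: card_V card_PiE)
qed

end

lemma symbol_index_less: "n * L + i < 3 * L" if "n < 3" "i < L" for n i L :: nat
proof -
  have "n * L + i < Suc n * L"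
    using that by simp
  also have "\<dots> \<le> 3 * L"
    using that by (intro mult_le_mono1) simp
  finally show ?thesis .
qed

section \<open>Vectors vanishing on whole files\<close>

locale file_code = linear_code Fq "3 * L" for Fq (structure) and L :: nat +
  assumes L: "L > 0"
begin

text \<open>Indexing by a set of files lets one cardinality formula serve the subgroups
  \<open>W n\<close> and all their intersections.\<close>

definition file_ker :: "nat set \<Rightarrow> (nat \<Rightarrow> nat) set" where
  "file_ker S = (\<Pi>\<^sub>E j\<in>{..<3 * L}. if j div L \<in> S then {\<zero>} else carrier Fq)"

lemma file_ker_Int: "file_ker S \<inter> file_ker T = file_ker (S \<union> T)"
  unfolding file_ker_def PiE_Int by (rule PiE_cong) auto

lemma card_blocks: "card {j \<in> {..<3 * L}. j div L \<in> S} = L * card (S \<inter> {..<3})"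
proof -
  have "bij_betw (\<lambda>(n, i). n * L + i) ((S \<inter> {..<3}) \<times> {..<L}) {j \<in> {..<3 * L}. j div L \<in> S}"
  proof (rule bij_betw_byWitness[where f' = "\<lambda>j. (j div L, j mod L)"])
    show "(\<lambda>(n, i). n * L + i) ` ((S \<inter> {..<3}) \<times> {..<L}) \<subseteq> {j \<in> {..<3 * L}. j div L \<in> S}"
      using symbol_index_less by (auto simp: div_mult_self3[OF less_imp_neq[OF L, symmetric]])
    show "\<forall>u\<in>(S \<inter> {..<3}) \<times> {..<L}. (\<lambda>j. (j div L, j mod L)) ((\<lambda>(n, i). n * L + i) u) = u"
      using L by auto
    show "\<forall>j\<in>{j \<in> {..<3 * L}. j div L \<in> S}. (\<lambda>(n, i). n * L + i) (j div L, j mod L) = j"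
      by simp
    show "(\<lambda>j. (j div L, j mod L)) ` {j \<in> {..<3 * L}. j div L \<in> S} \<subseteq> (S \<inter> {..<3}) \<times> {..<L}"
    proof (rule image_subsetI)
      fix j assume "j \<in> {j \<in> {..<3 * L}. j div L \<in> S}"
      then show "(j div L, j mod L) \<in> (S \<inter> {..<3}) \<times> {..<L}"
        using L less_mult_imp_div_less[of j 3 L] by simp
    qed
  qed
  from bij_betw_same_card[OF this] show ?thesis
    by (simp add: card_cartesian_product mult.commute)
qed

lemma card_file_ker:
  assumes "S \<subseteq> {..<3}"
  shows "card (file_ker S) = (card (carrier Fq) ^ L) ^ (3 - card S)"
proof -
  have *: "{..<3 * L} \<inter> {j. j div L \<notin> S} = {j \<in> {..<3 * L}. j div L \<in> {..<3} - S}"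
    by (auto dest: less_mult_imp_div_less)
  have "card (file_ker S) = (\<Prod>j<3 * L. if j div L \<in> S then 1 else card (carrier Fq))"
    unfolding file_ker_def by (subst card_PiE) (auto intro!: prod.cong)
  also have "\<dots> = card (carrier Fq) ^ card ({..<3 * L} \<inter> {j. j div L \<notin> S})"
    by (simp add: prod.If_cases Compl_eq)
  also have "card ({..<3 * L} \<inter> {j. j div L \<notin> S}) = L * card ({..<3} - S)"
    unfolding * card_blocks by (rule arg_cong[where f = "\<lambda>A. L * card A"]) auto
  finally show ?thesis
    using assms by (simp add: card_Diff_subset finite_subset power_mult)
qed

lemma subgroup_file_ker: "subgroup (file_ker S) V"
proof -
  let ?K = "\<lambda>j. if j div L \<in> S then {\<zero>} else carrier Fq"
  have A: "Group.group (add_monoid Fq)"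
    by (rule a_group)
  have K: "subgroup (?K j) (add_monoid Fq)" for j
    using group.triv_subgroup[OF A] group.subgroup_self[OF A] by (cases "j div L \<in> S") auto
  have "subgroup (Pi\<^sub>E {..<3 * L} ?K) (product_group {..<3 * L} (\<lambda>_. add_monoid Fq))"
    by (rule PiE_subgroup_product_group[THEN iffD2, OF A ballI[OF K]])
  then show ?thesis
    by (simp only: V_def file_ker_def)
qed

text \<open>Decoding compares two file vectors with equal observations; here these are
  \<open>v\<close> and the zero vector.\<close>

lemma decodes_ker:
  assumes "is_mat Fq m (3 * L) C" "is_mat Fq r (3 * L) Y" "decodes Fq L m C r Y d" "d < 3"
  shows "ker m C \<inter> ker r Y \<subseteq> file_ker {d}"
proof
  fix v assume v: "v \<in> ker m C \<inter> ker r Y"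
  then have vV: "v \<in> carrier V"
    by (simp add: ker_def)
  interpret V: comm_group V
    by (rule comm_group_V)
  have "is_vec Fq (3 * L) v" "is_vec Fq (3 * L) \<one>\<^bsub>V\<^esub>"
    using vV by (auto simp: is_vec_def carrier_V one_V)
  moreover have "lin_row Fq C (3 * L) i v = lin_row Fq C (3 * L) i \<one>\<^bsub>V\<^esub>" if "i < m" for i
    using v that lin_row_one[OF assms(1)] by (simp add: ker_def)
  moreover have "lin_row Fq Y (3 * L) i v = lin_row Fq Y (3 * L) i \<one>\<^bsub>V\<^esub>" if "i < r" for i
    using v that lin_row_one[OF assms(2)] by (simp add: ker_def)
  ultimately have v0: "v (d * L + i) = \<one>\<^bsub>V\<^esub> (d * L + i)" if "i < L" for i
    using assms(3) that unfolding decodes_def by blast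
  have "v j = \<zero>" if "j < 3 * L" "j div L = d" for j
    using v0[of "j mod L"] that L one_V[of j] by (metis div_mult_mod_eq mod_less_divisor)
  then show "v \<in> file_ker {d}"
    using vV by (auto simp: file_ker_def carrier_V PiE_iff)
qed

text \<open>Passing from the field size to its \<open>L\<close>-th power as base divides the
  logarithm by \<open>L\<close>, so that entropy is measured in files.\<close>

lemma log_card_ker:
  assumes "is_mat Fq r (3 * L) A" "real r \<le> c * real L"
  shows "3 - log (card (carrier Fq) ^ L) (card (ker r A)) \<le> c"
proof -
  let ?q = "real (card (carrier Fq))"
  have q: "?q > 1"
    using card_carrier_gt_1 by simp
  have pos: "card (ker r A) > 0"
    using card_ker[OF assms(1)] card_carrier_gt_1 by (metis gr0I le_zero_eq mult_0 not_one_less_zero power_eq_0_iff)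
  have "real (card (carrier Fq) ^ (3 * L)) \<le> real (card (ker r A) * card (carrier Fq) ^ r)"
    using card_ker[OF assms(1)] by (rule of_nat_mono)
  then have "log ?q (?q ^ (3 * L)) \<le> log ?q (card (ker r A) * ?q ^ r)"
    using q by (intro log_mono) auto
  then have "3 * real L \<le> log ?q (card (ker r A)) + real r"
    using q pos by (simp add: log_mult log_nat_power)
  then have "3 * real L - c * real L \<le> log ?q (card (ker r A))"
    using assms(2) by linarith
  then have "(3 * real L - c * real L) / real L \<le> log ?q (card (ker r A)) / real L"
    by (intro divide_right_mono) auto
  then have "3 - c \<le> log ?q (card (ker r A)) / real L"
    using L by (simp add: diff_divide_distrib)
  moreover have "log (?q ^ L) (card (ker r A)) = log ?q (card (ker r A)) / real L"
    using q L pos by (simp add: log_base_pow)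
  ultimately show ?thesis
    by simp
qed

end

lemma linear_achievable_group_caching:
  assumes "linear_achievable M R"
  obtains G :: "(nat \<Rightarrow> nat) monoid" and N W Z Y where "group_caching G N W Z Y M R"
proof -
  obtain Fq :: "nat ring" and L m C where F: "field Fq" "finite (carrier Fq)" "L > 0"
    and C: "\<forall>k<3. real (m k) \<le> M * real L \<and> is_mat Fq (m k) (3 * L) (C k)"
    and ex: "\<forall>D::nat \<Rightarrow> nat. (\<forall>k<3. D k < 3) \<longrightarrow> (\<exists>r Y. real r \<le> R * real L \<and> is_mat Fq r (3 * L) Y \<and>
                (\<forall>k<3. decodes Fq L (m k) (C k) r Y (D k)))"
    using assms unfolding linear_achievable_def by (elim exE conjE) (rule that)
  interpret file_code Fq L
    by (intro file_code.intro linear_code.intro linear_code_axioms.intro file_code_axioms.intro F)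
  define ok where "ok D rY \<longleftrightarrow> real (fst rY) \<le> R * real L \<and> is_mat Fq (fst rY) (3 * L) (snd rY) \<and>
                (\<forall>k<3. decodes Fq L (m k) (C k) (fst rY) (snd rY) (D k))" for D :: "nat \<Rightarrow> nat" and rY
  \<comment> \<open>A pair, so that one choice fixes the number of rows together with the
    matrix.\<close>
  define rY where "rY D = (SOME rY. ok D rY)" for D
  have ok: "ok D (rY D)" if "demand D" for D
  proof -
    from ex[THEN spec, THEN mp, OF that[unfolded demand_def]] obtain r Y where "ok D (r, Y)"
      by (elim exE) (simp only: ok_def fst_conv snd_conv)
    then show ?thesis
      unfolding rY_def by (rule someI)
  qed
  note Y = ok[unfolded ok_def]
  interpret V: comm_group V
    by (rule comm_group_V)
  have N1: "1 < card (carrier Fq) ^ L"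
    using card_carrier_gt_1 L by (metis one_less_power)
  have N3: "card (carrier V) = (card (carrier Fq) ^ L) ^ 3"
    by (simp only: card_V power_mult[symmetric] mult.commute[of L 3])
  have W1: "card (file_ker {n}) = (card (carrier Fq) ^ L) ^ 2" if "n < 3" for n
    using card_file_ker[of "{n}"] that by simp
  have W2: "card (file_ker {n} \<inter> file_ker {n'}) = card (carrier Fq) ^ L" if "n < 3" "n' < 3" "n \<noteq> n'" for n n'
    using card_file_ker[of "{n, n'}"] that by (simp add: file_ker_Int insert_commute)
  have W3: "card (file_ker {0} \<inter> file_ker {1} \<inter> file_ker {2}) = 1"
    using card_file_ker[of "{0, 1, 2}"] by (simp add: file_ker_Int insert_commute)
  have Z1: "3 - log (card (carrier Fq) ^ L) (card (ker (m k) (C k))) \<le> M" if "k < 3" for k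
    using C that by (intro log_card_ker) auto
  have Y1: "3 - log (card (carrier Fq) ^ L) (card (ker (fst (rY D)) (snd (rY D)))) \<le> R" if "demand D" for D
    using Y[OF that] by (intro log_card_ker) auto
  have dec: "ker (m k) (C k) \<inter> ker (fst (rY D)) (snd (rY D)) \<subseteq> file_ker {D k}" if "demand D" "k < 3" for D k
    using Y[OF that(1)] C that by (intro decodes_ker) (auto simp: demand_def)
  have Zs: "subgroup (ker (m k) (C k)) V" if "k < 3" for k
    using C that by (intro subgroup_ker) auto
  have Ys: "subgroup (ker (fst (rY D)) (snd (rY D))) V" if "demand D" for D
    using Y[OF that] by (intro subgroup_ker) auto
  have "group_caching V (card (carrier Fq) ^ L) (\<lambda>n. file_ker {n}) (\<lambda>k. ker (m k) (C k))
      (\<lambda>D. ker (fst (rY D)) (snd (rY D))) M R"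
    by (intro group_caching.intro group_caching_axioms.intro comm_group_V finite_V N1 N3 subgroup_file_ker
        Zs Ys W1 W2 W3 Z1 Y1 dec)
  then show ?thesis
    by (rule that)
qed

subsection \<open>Schemes over the field with two elements\<close>

type_synonym sym = "nat \<times> nat"

text \<open>An inner list is the sum of its symbols over the field with two elements.
  \<open>v\<close> marks where two file vectors differ; equal observations mean an even number of
  marks in each sum.\<close>

definition annihilates :: "(sym \<Rightarrow> bool) \<Rightarrow> sym list list \<Rightarrow> bool" where
  "annihilates v pss \<longleftrightarrow> (\<forall>ps\<in>set pss. even (length (filter v ps)))"

definition recovers :: "nat \<Rightarrow> sym list list \<Rightarrow> nat \<Rightarrow> bool" where
  "recovers L pss d \<longleftrightarrow> (\<forall>v. annihilates v pss \<longrightarrow> (\<forall>i<L. \<not> v (d, i)))"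

section \<open>Gaussian elimination on lists of symbols\<close>

definition toggle :: "sym \<Rightarrow> sym list \<Rightarrow> sym list" where
  "toggle s ps = (if s \<in> set ps then remove1 s ps else s # ps)"

definition xor_list :: "sym list \<Rightarrow> sym list \<Rightarrow> sym list" where
  "xor_list ps ps' = fold toggle ps ps'"

text \<open>Partially applied constants instead of abstractions keep \<open>code_simp\<close> from rewriting under
  binders.\<close>

definition eliminate :: "sym \<Rightarrow> sym list \<Rightarrow> sym list \<Rightarrow> sym list" where
  "eliminate s ps qs = (if s \<in> set qs then xor_list (s # ps) qs else qs)"

text \<open>The head of a row is its pivot. It is cleared from finished rows too, so that a symbol
  in the row space ends as a row of its own.\<close>

fun gauss :: "sym list list \<Rightarrow> sym list list \<Rightarrow> sym list list" where
  "gauss [] done = done"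
| "gauss ([] # pss) done = gauss pss done"
| "gauss ((s # ps) # pss) done = gauss (map (eliminate s ps) pss) ((s # ps) # map (eliminate s ps) done)"

lemma even_filter_remove1:
  "s \<in> set ps \<Longrightarrow> even (length (filter v (remove1 s ps))) \<longleftrightarrow> even (length (filter v ps)) \<noteq> v s"
  by (induction ps) auto

lemma even_toggle: "even (length (filter v (toggle s ps))) \<longleftrightarrow> even (length (filter v ps)) \<noteq> v s"
  by (auto simp: toggle_def even_filter_remove1)

lemma even_xor_list:
  "even (length (filter v (xor_list ps ps'))) \<longleftrightarrow>
     even (length (filter v ps)) = even (length (filter v ps'))"
  unfolding xor_list_def by (induction ps arbitrary: ps') (auto simp: even_toggle)

lemma annihilates_gauss:
  "annihilates v pss \<Longrightarrow> annihilates v done \<Longrightarrow> annihilates v (gauss pss done)"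
proof (induction pss "done" rule: gauss.induct)
  case (1 "done")
  then show ?case
    by simp
next
  case (2 pss "done")
  have "annihilates v pss"
    using 2(2) unfolding annihilates_def by (meson list.set_intros(2))
  then show ?case
    unfolding gauss.simps using 2(3) by (rule 2(1))
next
  case (3 s ps pss "done")
  have sps: "even (length (filter v (s # ps)))"
    using 3(2) unfolding annihilates_def by (meson list.set_intros(1))
  have elim: "even (length (filter v (eliminate s ps qs)))" if "even (length (filter v qs))" for qs
    using sps that unfolding eliminate_def by (cases "s \<in> set qs") (simp_all only: even_xor_list if_True if_False simp_thms)
  have map_elim: "annihilates v (map (eliminate s ps) qss)" if "annihilates v qss" for qss
    using that elim unfolding annihilates_def set_map by blast
  have "annihilates v pss"
    using 3(2) unfolding annihilates_def by (meson list.set_intros(2))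
  moreover have "annihilates v ((s # ps) # map (eliminate s ps) done)"
    using sps map_elim[OF 3(3)] unfolding annihilates_def list.set by blast
  ultimately show ?case
    unfolding gauss.simps using map_elim by (intro 3(1))
qed

text \<open>Repeated symbols cancel; otherwise \<open>toggle\<close>, which removes one occurrence,
  could leave a pivot behind.\<close>

definition reduce :: "sym list \<Rightarrow> sym list" where
  "reduce ps = xor_list ps []"

definition unit_in :: "sym list list \<Rightarrow> nat \<Rightarrow> nat \<Rightarrow> bool" where
  "unit_in pss d i \<longleftrightarrow> [(d, i)] \<in> set pss"

definition recover_test :: "nat \<Rightarrow> sym list list \<Rightarrow> nat \<Rightarrow> bool" where
  "recover_test L pss d \<longleftrightarrow> list_all (unit_in (gauss (map reduce pss) []) d) [0..<L]"

lemma recover_test: "recover_test L pss d \<Longrightarrow> recovers L pss d"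
  unfolding recovers_def
proof (intro allI impI notI)
  fix v i assume test: "recover_test L pss d" and v: "annihilates v pss" and i: "i < L" "v (d, i)"
  have "annihilates v (gauss (map reduce pss) [])"
    using v by (intro annihilates_gauss) (auto simp: annihilates_def reduce_def even_xor_list)
  moreover have "[(d, i)] \<in> set (gauss (map reduce pss) [])"
    using test i by (simp add: recover_test_def unit_in_def list_all_iff)
  ultimately have "even (length (filter v [(d, i)]))"
    unfolding annihilates_def by blast
  with i(2) show False
    by simp
qed

definition valid :: "nat \<Rightarrow> sym list list \<Rightarrow> bool" where
  "valid L pss \<longleftrightarrow> (\<forall>ps\<in>set pss. \<forall>s\<in>set ps. fst s < 3 \<and> snd s < L)"

definition scheme :: "nat \<Rightarrow> nat \<Rightarrow> nat \<Rightarrow> bool" where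
  "scheme L m r \<longleftrightarrow> (\<exists>C. (\<forall>k<3. length (C k) \<le> m \<and> valid L (C k)) \<and>
     (\<forall>D. demand D \<longrightarrow> (\<exists>Y. length Y \<le> r \<and> valid L Y \<and> (\<forall>k<3. recovers L (Y @ C k) (D k)))))"

definition cache_test :: "nat \<Rightarrow> nat \<Rightarrow> (nat \<Rightarrow> sym list list) \<Rightarrow> nat \<Rightarrow> bool" where
  "cache_test L m C k \<longleftrightarrow> length (C k) \<le> m \<and> valid L (C k)"

definition user_test :: "nat \<Rightarrow> (nat \<Rightarrow> sym list list) \<Rightarrow> nat list \<Rightarrow> sym list list \<Rightarrow> nat \<Rightarrow> bool" where
  "user_test L C D Y k \<longleftrightarrow> recover_test L (Y @ C k) (D ! k)"

definition delivery_test :: "nat \<Rightarrow> nat \<Rightarrow> (nat \<Rightarrow> sym list list) \<Rightarrow> nat list \<Rightarrow> sym list list \<Rightarrow> bool" where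
  "delivery_test L r C D Y \<longleftrightarrow> length Y \<le> r \<and> valid L Y \<and> list_all (user_test L C D Y) [0, 1, 2]"

definition demand_test :: "nat \<Rightarrow> nat \<Rightarrow> (nat \<Rightarrow> sym list list) \<Rightarrow> (nat list \<Rightarrow> sym list list) \<Rightarrow> nat list \<Rightarrow> bool" where
  "demand_test L r C Y D \<longleftrightarrow> delivery_test L r C D (Y D)"

definition scheme_test :: "nat \<Rightarrow> nat \<Rightarrow> nat \<Rightarrow> (nat \<Rightarrow> sym list list) \<Rightarrow> (nat list \<Rightarrow> sym list list) \<Rightarrow> bool" where
  "scheme_test L m r C Y \<longleftrightarrow>
     list_all (cache_test L m C) [0, 1, 2] \<and> list_all (demand_test L r C Y) (List.n_lists 3 [0, 1, 2])"

lemma scheme_testD: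
  assumes "scheme_test L m r C Y"
  shows "scheme L m r"
  unfolding scheme_def
proof (intro exI[of _ C] conjI allI impI)
  have three: "k = 0 \<or> k = 1 \<or> k = 2" if "k < 3" for k :: nat
    using that by auto
  show "length (C k) \<le> m" "valid L (C k)" if "k < 3" for k
    using assms three[OF that] by (auto simp: scheme_test_def cache_test_def)
  fix D assume D: "demand D"
  \<comment> \<open>A demand is read at three users only, so 27 lists cover all demand
    functions.\<close>
  let ?D = "[D 0, D 1, D 2]"
  have "?D \<in> set (List.n_lists 3 [0, 1, 2])"
    using D three by (fastforce simp: set_n_lists demand_def)
  then have "demand_test L r C Y ?D"
    using assms by (simp only: scheme_test_def list_all_iff)
  then show "\<exists>Y. length Y \<le> r \<and> valid L Y \<and> (\<forall>k<3. recovers L (Y @ C k) (D k))"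
    using three
    by (intro exI[of _ "Y ?D"]) (fastforce simp: demand_test_def delivery_test_def user_test_def dest!: recover_test)
qed

section \<open>Memory sharing\<close>

definition embed :: "nat \<Rightarrow> sym list list \<Rightarrow> sym list list" where
  "embed L pss = map (map (apsnd ((+) L))) pss"

lemma length_embed [simp]: "length (embed L pss) = length pss"
  by (simp add: embed_def)

lemma annihilates_append [simp]: "annihilates v (pss @ qss) \<longleftrightarrow> annihilates v pss \<and> annihilates v qss"
  by (auto simp: annihilates_def)

lemma annihilates_embed: "annihilates v (embed L pss) \<longleftrightarrow> annihilates (v \<circ> apsnd ((+) L)) pss"
  by (simp add: annihilates_def embed_def filter_map)

lemma valid_append_embed: "valid L pss \<Longrightarrow> valid L' qss \<Longrightarrow> valid (L + L') (pss @ embed L qss)"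
  by (fastforce simp: valid_def embed_def)

text \<open>The first scheme recovers the first \<open>L\<close> symbols of the file, the second the
  others, applied to \<open>v\<close> pulled back along the index shift.\<close>

lemma recovers_append_embed:
  assumes "recovers L (pss @ qss) d" "recovers L' (pss' @ qss') d"
  shows "recovers (L + L') ((pss @ embed L pss') @ (qss @ embed L qss')) d"
  unfolding recovers_def
proof (intro allI impI)
  fix v i assume v: "annihilates v ((pss @ embed L pss') @ (qss @ embed L qss'))" and i: "i < L + L'"
  show "\<not> v (d, i)"
  proof (cases "i < L")
    case True
    have "annihilates v (pss @ qss)"
      using v by simp
    with True show ?thesis
      using assms(1) unfolding recovers_def by blast
  next
    case False
    then have "i - L < L'"
      using i by simp
    moreover have "annihilates (v \<circ> apsnd ((+) L)) (pss' @ qss')"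
      using v by (simp add: annihilates_embed)
    ultimately have "\<not> (v \<circ> apsnd ((+) L)) (d, i - L)"
      using assms(2) unfolding recovers_def by blast
    then show ?thesis
      using False by simp
  qed
qed

lemma scheme_add:
  assumes "scheme L m r" "scheme L' m' r'"
  shows "scheme (L + L') (m + m') (r + r')"
proof -
  obtain C where C: "\<And>k. k < 3 \<Longrightarrow> length (C k) \<le> m \<and> valid L (C k)"
    and Y: "\<And>D. demand D \<Longrightarrow> \<exists>Y. length Y \<le> r \<and> valid L Y \<and> (\<forall>k<3. recovers L (Y @ C k) (D k))"
    using assms(1) unfolding scheme_def by blast
  obtain C' where C': "\<And>k. k < 3 \<Longrightarrow> length (C' k) \<le> m' \<and> valid L' (C' k)"
    and Y': "\<And>D. demand D \<Longrightarrow> \<exists>Y. length Y \<le> r' \<and> valid L' Y \<and> (\<forall>k<3. recovers L' (Y @ C' k) (D k))"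
    using assms(2) unfolding scheme_def by blast
  show ?thesis
    unfolding scheme_def
  proof (intro exI[of _ "\<lambda>k. C k @ embed L (C' k)"] conjI allI impI)
    show "length (C k @ embed L (C' k)) \<le> m + m'" "valid (L + L') (C k @ embed L (C' k))" if "k < 3" for k
      using C[OF that] C'[OF that] by (simp_all add: valid_append_embed)
    fix D assume D: "demand D"
    obtain y y' where "length y \<le> r" "valid L y" "\<forall>k<3. recovers L (y @ C k) (D k)"
      "length y' \<le> r'" "valid L' y'" "\<forall>k<3. recovers L' (y' @ C' k) (D k)"
      using Y[OF D] Y'[OF D] by blast
    then show "\<exists>Y. length Y \<le> r + r' \<and> valid (L + L') Y \<and>
        (\<forall>k<3. recovers (L + L') (Y @ C k @ embed L (C' k)) (D k))"
      by (intro exI[of _ "y @ embed L y'"] conjI allI impI valid_append_embed recovers_append_embed) auto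
  qed
qed

lemma scheme_0: "scheme 0 0 0"
  unfolding scheme_def
  by (intro exI[of _ "\<lambda>_. []"] conjI allI impI exI[of _ "[]"]) (simp_all add: valid_def recovers_def)

lemma scheme_scale: "scheme L m r \<Longrightarrow> scheme (a * L) (a * m) (a * r)"
  by (induction a) (simp_all add: scheme_0 scheme_add)

section \<open>Binary schemes as matrices over the field with two elements\<close>

definition gf2 :: "nat ring" where
  "gf2 = \<lparr>carrier = {0, 1}, monoid.mult = (*), one = 1, ring.zero = 0, ring.add = \<lambda>a b. (a + b) mod 2\<rparr>"

lemma gf2_simps [simp]:
  "carrier gf2 = {0, 1}" "\<one>\<^bsub>gf2\<^esub> = 1" "\<zero>\<^bsub>gf2\<^esub> = 0"
  "a \<otimes>\<^bsub>gf2\<^esub> b = a * b" "a \<oplus>\<^bsub>gf2\<^esub> b = (a + b) mod 2"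
  by (simp_all add: gf2_def)

lemma field_gf2: "field gf2"
proof -
  interpret cring gf2
  proof (rule cringI)
    show "abelian_group gf2"
      by (rule abelian_groupI) auto
    show "comm_monoid gf2"
      by (rule comm_monoidI) auto
  qed auto
  show ?thesis
    by (rule cring_fieldI2) auto
qed

lemma finsum_gf2:
  assumes "finite A" "\<And>j. j \<in> A \<Longrightarrow> f j < 2"
  shows "finsum gf2 f A = (\<Sum>j\<in>A. f j) mod 2"
proof -
  interpret field gf2
    by (rule field_gf2)
  have c: "f j \<in> carrier gf2" if "j \<in> A" for j
    using assms(2)[OF that] by auto
  show ?thesis
    using assms(1) c
  proof (induction A)
    case (insert j A)
    then have "finsum gf2 f (insert j A) = f j \<oplus>\<^bsub>gf2\<^esub> finsum gf2 f A"
      by (intro finsum_insert) auto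
    also have "\<dots> = (f j + (\<Sum>j\<in>A. f j) mod 2) mod 2"
      using insert.IH insert.prems by (simp add: insert_iff del: gf2_simps(1))
    finally show ?case
      using insert.hyps by (simp add: mod_add_right_eq)
  qed simp
qed

text \<open>Counting modulo 2 agrees with the parity in \<open>annihilates\<close> even when a
  symbol is repeated.\<close>

definition matrix_of :: "nat \<Rightarrow> sym list list \<Rightarrow> nat \<Rightarrow> nat \<Rightarrow> nat" where
  "matrix_of L pss i j = count_list (pss ! i) (j div L, j mod L) mod 2"

lemma is_mat_matrix_of: "is_mat gf2 r n (matrix_of L pss)"
  by (auto simp: is_mat_def matrix_of_def)

lemma sum_count_list:
  fixes w :: "nat \<Rightarrow> nat"
  assumes "\<forall>s\<in>set ps. fst s < 3 \<and> snd s < L"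
  shows "(\<Sum>j<3 * L. count_list ps (j div L, j mod L) * w j) = (\<Sum>s\<leftarrow>ps. w (fst s * L + snd s))"
  using assms
proof (induction ps)
  case (Cons s ps)
  obtain n i where s: "s = (n, i)"
    by fastforce
  have ni: "n < 3" "i < L"
    using Cons.prems s by auto
  then have lt: "n * L + i < 3 * L"
    by (rule symbol_index_less)
  have eq: "(j div L, j mod L) = s \<longleftrightarrow> j = n * L + i" for j
    using ni s by auto
  have "(\<Sum>j<3 * L. count_list (s # ps) (j div L, j mod L) * w j) =
      (\<Sum>j<3 * L. (if j = n * L + i then w j else 0) + count_list ps (j div L, j mod L) * w j)"
    by (intro sum.cong) (auto simp: eq eq_commute[of s])
  also have "\<dots> = w (n * L + i) + (\<Sum>s\<leftarrow>ps. w (fst s * L + snd s))"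
    using Cons lt by (simp add: sum.distrib)
  finally show ?case
    by (simp add: s)
qed simp

lemma lin_row_matrix_of:
  assumes "\<forall>s\<in>set (pss ! i). fst s < 3 \<and> snd s < L" "is_vec gf2 (3 * L) w"
  shows "lin_row gf2 (matrix_of L pss) (3 * L) i w = (\<Sum>s\<leftarrow>pss ! i. w (fst s * L + snd s)) mod 2"
proof -
  have w: "w j < 2" if "j < 3 * L" for j
    using assms(2) that by (fastforce simp: is_vec_def)
  have b: "matrix_of L pss i j * w j < 2" if "j < 3 * L" for j
  proof -
    have "matrix_of L pss i j \<le> 1"
      by (simp add: matrix_of_def)
    then have "matrix_of L pss i j * w j \<le> 1 * 1"
      using w[OF that] by (intro mult_le_mono) auto
    then show ?thesis
      by simp
  qed
  have "lin_row gf2 (matrix_of L pss) (3 * L) i w = (\<Sum>j<3 * L. matrix_of L pss i j * w j) mod 2"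
    unfolding lin_row_def gf2_simps(4) by (rule finsum_gf2) (simp_all add: b)
  also have "\<dots> = (\<Sum>j<3 * L. matrix_of L pss i j * w j mod 2) mod 2"
    by (rule mod_sum_eq[symmetric])
  also have "\<dots> = (\<Sum>j<3 * L. count_list (pss ! i) (j div L, j mod L) * w j mod 2) mod 2"
    by (simp only: matrix_of_def mod_mult_left_eq)
  also have "\<dots> = (\<Sum>j<3 * L. count_list (pss ! i) (j div L, j mod L) * w j) mod 2"
    by (rule mod_sum_eq)
  finally show ?thesis
    by (simp add: sum_count_list[OF assms(1)])
qed

lemma even_filter_neq:
  assumes "\<forall>s\<in>set ps. f s < 2 \<and> g s < (2::nat)" "sum_list (map f ps) mod 2 = sum_list (map g ps) mod 2"
  shows "even (length (filter (\<lambda>s. f s \<noteq> g s) ps))"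
proof -
  have "even (length (filter (\<lambda>s. f s \<noteq> g s) ps)) \<longleftrightarrow> even (sum_list (map f ps) + sum_list (map g ps))"
    using assms(1) by (induction ps) (auto simp: less_2_cases_iff)
  moreover have "even (x + y)" if "x mod 2 = y mod 2" for x y :: nat
    using that by presburger
  ultimately show ?thesis
    using assms(2) by blast
qed

lemma decodes_matrix_of:
  assumes "valid L C" "valid L Y" "recovers L (Y @ C) d" "d < 3"
  shows "decodes gf2 L (length C) (matrix_of L C) (length Y) (matrix_of L Y) d"
  unfolding decodes_def
proof (intro allI impI)
  fix w w' i
  assume w: "is_vec gf2 (3 * L) w" "is_vec gf2 (3 * L) w'"
    and C: "\<forall>i<length C. lin_row gf2 (matrix_of L C) (3 * L) i w = lin_row gf2 (matrix_of L C) (3 * L) i w'"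
    and Y: "\<forall>i<length Y. lin_row gf2 (matrix_of L Y) (3 * L) i w = lin_row gf2 (matrix_of L Y) (3 * L) i w'"
    and i: "i < L"
  \<comment> \<open>The difference of the two file vectors as a set of symbols; every row of cache
    and message meets it evenly.\<close>
  define v where "v = (\<lambda>s. w (fst s * L + snd s) \<noteq> w' (fst s * L + snd s))"
  have w2: "w j < 2" "w' j < 2" if "j < 3 * L" for j
    using w that by (fastforce simp: is_vec_def)+
  have ann: "annihilates v pss" if "valid L pss"
    and eq: "\<forall>i<length pss. lin_row gf2 (matrix_of L pss) (3 * L) i w = lin_row gf2 (matrix_of L pss) (3 * L) i w'"
    for pss
    unfolding annihilates_def
  proof
    fix ps assume "ps \<in> set pss"
    then obtain l where l: "l < length pss" "ps = pss ! l"
      by (metis in_set_conv_nth)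
    have ps: "\<forall>s\<in>set (pss ! l). fst s < 3 \<and> snd s < L"
      using \<open>valid L pss\<close> \<open>ps \<in> set pss\<close> unfolding valid_def l(2) by blast
    have "\<forall>s\<in>set (pss ! l). w (fst s * L + snd s) < 2 \<and> w' (fst s * L + snd s) < 2"
      using ps w2 symbol_index_less by blast
    moreover have "sum_list (map (\<lambda>s. w (fst s * L + snd s)) (pss ! l)) mod 2 =
        sum_list (map (\<lambda>s. w' (fst s * L + snd s)) (pss ! l)) mod 2"
      using eq l(1) lin_row_matrix_of[OF ps w(1)] lin_row_matrix_of[OF ps w(2)] by metis
    ultimately show "even (length (filter v ps))"
      unfolding v_def l(2) by (rule even_filter_neq)
  qed
  have "annihilates v (Y @ C)"
    using ann[OF assms(1) C] ann[OF assms(2) Y] by simp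
  with i have "\<not> v (d, i)"
    using assms(3) unfolding recovers_def by blast
  then show "w (d * L + i) = w' (d * L + i)"
    by (simp add: v_def)
qed

lemma scheme_linear_achievable:
  assumes "scheme L m r" "L > 0" "real m \<le> M * real L" "real r \<le> R * real L"
  shows "linear_achievable M R"
proof -
  obtain C where C: "\<And>k. k < 3 \<Longrightarrow> length (C k) \<le> m \<and> valid L (C k)"
    and Y: "\<And>D. demand D \<Longrightarrow> \<exists>Y. length Y \<le> r \<and> valid L Y \<and> (\<forall>k<3. recovers L (Y @ C k) (D k))"
    using assms(1) unfolding scheme_def by blast
  show ?thesis
    unfolding linear_achievable_def
  proof (rule exI[of _ gf2], rule exI[of _ L], intro conjI field_gf2 assms(2))
    show "finite (carrier gf2)"
      by simp
    show "\<exists>m C. (\<forall>k<3. real (m k) \<le> M * real L \<and> is_mat gf2 (m k) (3 * L) (C k)) \<and>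
          (\<forall>D::nat \<Rightarrow> nat. (\<forall>k<3. D k < 3) \<longrightarrow> (\<exists>r Y. real r \<le> R * real L \<and> is_mat gf2 r (3 * L) Y \<and>
             (\<forall>k<3::nat. decodes gf2 L (m k) (C k) r Y (D k))))"
    proof (rule exI[of _ "\<lambda>k. length (C k)"], rule exI[of _ "\<lambda>k. matrix_of L (C k)"], intro conjI allI impI is_mat_matrix_of)
      show "real (length (C k)) \<le> M * real L" if "k < 3" for k
        using C[OF that] assms(3) by linarith
      fix D :: "nat \<Rightarrow> nat" assume "\<forall>k<3. D k < 3"
      then have D: "demand D"
        by (simp add: demand_def)
      then obtain y where y: "length y \<le> r" "valid L y" "\<forall>k<3. recovers L (y @ C k) (D k)"
        using Y by blast
      show "\<exists>r Y. real r \<le> R * real L \<and> is_mat gf2 r (3 * L) Y \<and>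
             (\<forall>k<3::nat. decodes gf2 L (length (C k)) (matrix_of L (C k)) r Y (D k))"
      proof (rule exI[of _ "length y"], rule exI[of _ "matrix_of L y"], intro conjI allI impI is_mat_matrix_of)
        show "real (length y) \<le> R * real L"
          using y(1) assms(4) by linarith
        show "decodes gf2 L (length (C k)) (matrix_of L (C k)) (length y) (matrix_of L y) (D k)" if "k < 3" for k
          using y C[OF that] D that by (intro decodes_matrix_of) (auto simp: demand_def)
      qed
    qed
  qed
qed

subsection \<open>Schemes for the corner points\<close>

text \<open>The scheme for (3/5, 3/2).  File \<open>n\<close> consists of a symbol \<open>(n, 0)\<close>, and for every user \<open>k\<close> of
  \<open>(n, 3k + 1)\<close>, \<open>(n, 3k + 2)\<close>, \<open>(n, 3k + 3)\<close>.  For each of the two other files \<open>n'\<close>, user \<open>k\<close> has a share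
  \<open>cpart n k n'\<close> of the common symbol, the two shares adding up to \<open>(n, 0)\<close>, and a private symbol
  \<open>epart n k n'\<close>; the cache masks each share by a private symbol of the other file.\<close>

definition cpart :: "nat \<Rightarrow> nat \<Rightarrow> nat \<Rightarrow> sym list" where
  "cpart n k n' = (if n' = (n + 1) mod 3 then [(n, 1 + 3 * k)] else [(n, 0), (n, 1 + 3 * k)])"

definition epart :: "nat \<Rightarrow> nat \<Rightarrow> nat \<Rightarrow> sym list" where
  "epart n k n' = [(n, 3 * k + (if n' = (n + 1) mod 3 then 2 else 3))]"

definition cache10 :: "nat \<Rightarrow> sym list list" where
  "cache10 k = [cpart n k n' @ epart n' k n. n \<leftarrow> [0, 1, 2], n' \<leftarrow> [0, 1, 2], n \<noteq> n']"

text \<open>The first block lets user \<open>k\<close> requesting \<open>d\<close> unmask its cache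
  entries involving \<open>d\<close>: its shares add up to \<open>(d, 0)\<close>, and its private
  symbols of \<open>d\<close> appear. For each other user \<open>k'\<close> it then lacks
  \<open>epart d k' n\<close>, where \<open>n\<close> is the file that neither requests. The last
  block adds \<open>(n, 0)\<close> and \<open>epart (D ! k') k n\<close> to it; their sum is known
  to user \<open>k\<close> as the cached \<open>cpart n k (D ! k') @ epart (D ! k') k n\<close> plus
  the delivered \<open>cpart n k d\<close>.\<close>

definition deliver10_distinct :: "nat list \<Rightarrow> sym list list" where
  "deliver10_distinct D =
     concat [[cpart n k (D ! k), epart n k (D ! k)]. n \<leftarrow> [0, 1, 2], k \<leftarrow> [0, 1, 2], D ! k \<noteq> n] @
     [(n, 0) # concat [epart (D ! k') k n. k \<leftarrow> [0, 1, 2], D ! k \<noteq> n, k' \<leftarrow> [0, 1, 2], D ! k' \<noteq> n, k \<noteq> k']. n \<leftarrow> [0, 1, 2]]"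

text \<open>Users \<open>u\<close>, \<open>v\<close> request file \<open>a\<close>, user \<open>t\<close> requests \<open>b\<close>.\<close>

definition deliver10_two :: "nat \<Rightarrow> nat \<Rightarrow> nat \<Rightarrow> nat \<Rightarrow> nat \<Rightarrow> sym list list" where
  "deliver10_two a b u v t =
     [[(a, 3 * t + j)]. j \<leftarrow> [1, 2, 3]] @ [[(b, 3 * k + j)]. k \<leftarrow> [u, v], j \<leftarrow> [1, 2, 3]] @
     [cpart a u b @ cpart a v b, epart a u b @ epart a v b, epart a u (3 - a - b) @ epart a v (3 - a - b),
      [(a, 0)], [(b, 0)], [(3 - a - b, 0)]]"

text \<open>The branches are for three, two and one distinct requests.\<close>

definition by_demand :: "(nat list \<Rightarrow> 'b) \<Rightarrow> (nat \<Rightarrow> nat \<Rightarrow> nat \<Rightarrow> nat \<Rightarrow> nat \<Rightarrow> 'b) \<Rightarrow> (nat \<Rightarrow> 'b) \<Rightarrow> nat list \<Rightarrow> 'b" where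
  "by_demand f g h D =
     (let a = D ! 0; b = D ! 1; c = D ! 2 in
      if a = b then (if b = c then h a else g a c 0 1 2)
      else if a = c then g a b 0 2 1 else if b = c then g b a 1 2 0 else f D)"

text \<open>The scheme for (1/2, 5/3): \<open>part6 n k n'\<close> is the part of file \<open>n\<close> that user \<open>k\<close> caches masked by
  the corresponding part of file \<open>n'\<close>.\<close>

definition part6 :: "nat \<Rightarrow> nat \<Rightarrow> nat \<Rightarrow> sym" where
  "part6 n k n' = (n, 2 * k + (if n' = (n + 1) mod 3 then 0 else 1))"

definition cache6 :: "nat \<Rightarrow> sym list list" where
  "cache6 k = [[part6 n k n', part6 n' k n]. (n, n') \<leftarrow> [(0, 1), (0, 2), (1, 2)]]"

text \<open>User \<open>l\<close> finds the sum of \<open>own l\<close> in its cache, so the six combinations of \<open>p l k\<close> with \<open>own l\<close>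
  for \<open>l \<noteq> k\<close> serve everyone; for fixed \<open>k\<close> both of them add up to the sum of \<open>own 0\<close>, \<open>own 1\<close> and
  \<open>own 2\<close>, hence four of the six suffice.\<close>

definition deliver6_distinct :: "nat list \<Rightarrow> sym list list" where
  "deliver6_distinct D =
     (let p = (\<lambda>l k. part6 (D ! l) k (D ! (3 - k - l)));
          own = (\<lambda>k. [p l k. l \<leftarrow> [0, 1, 2], l \<noteq> k])
      in [[part6 (D ! l) k (D ! k)]. k \<leftarrow> [0, 1, 2], l \<leftarrow> [0, 1, 2], l \<noteq> k] @
         [p 0 1 # own 0, p 2 1 # own 2, p 0 2 # own 0, p 1 0 # own 1])"

text \<open>Users \<open>u\<close> and \<open>v\<close> unmask \<open>part6 a u b\<close> and
  \<open>part6 a v b\<close> with the parts of \<open>b\<close> sent, so their sum gives each the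
  other's part. User \<open>t\<close> unmasks \<open>part6 b t a\<close> with the parts of
  \<open>a\<close> sent.\<close>

definition deliver6_two :: "nat \<Rightarrow> nat \<Rightarrow> nat \<Rightarrow> nat \<Rightarrow> nat \<Rightarrow> sym list list" where
  "deliver6_two a b u v t =
     [[(a, 2 * t)], [(a, 2 * t + 1)]] @ [[(b, 2 * k + j)]. k \<leftarrow> [u, v], j \<leftarrow> [0, 1]] @
     [[part6 a u b, part6 a v b], [part6 a u (3 - a - b)], [part6 a v (3 - a - b)], [part6 b t (3 - a - b)]]"

definition whole_file :: "nat \<Rightarrow> nat \<Rightarrow> sym list list" where
  "whole_file L a = [[(a, i)]. i \<leftarrow> [0..<L]]"

lemma scheme_1_2: "scheme 6 3 10"
proof (rule scheme_testD)
  show "scheme_test 6 3 10 cache6 (by_demand deliver6_distinct deliver6_two (whole_file 6))"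
    by code_simp
qed

text \<open>Coded placement: for distinct requests, user \<open>l\<close> receives the symbols with
  index \<open>l\<close> of the two other files and removes them from its cached sum.\<close>

lemma scheme_1_3: "scheme 3 1 6"
proof (rule scheme_testD)
  show "scheme_test 3 1 6 (\<lambda>k. [[(0, k), (1, k), (2, k)]])
    (by_demand (\<lambda>D. [[(D ! k, l)]. k \<leftarrow> [0, 1, 2], l \<leftarrow> [0, 1, 2], l \<noteq> k])
      (\<lambda>a b u v t. whole_file 3 a @ whole_file 3 b) (whole_file 3))"
    by code_simp
qed

text \<open>Uncoded placement: each sum serves two users, either of whom caches the symbol wanted by
  the other.\<close>

lemma scheme_1_1: "scheme 3 3 3"
proof (rule scheme_testD)
  show "scheme_test 3 3 3 (\<lambda>k. [[(0, k)], [(1, k)], [(2, k)]])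
    (\<lambda>D. [[(D ! 0, 1), (D ! 1, 0)], [(D ! 0, 2), (D ! 2, 0)], [(D ! 1, 2), (D ! 2, 1)]])"
    by code_simp
qed

lemma scheme_2_1: "scheme 3 6 1"
proof (rule scheme_testD)
  show "scheme_test 3 6 1 (\<lambda>k. [[(n, l)]. n \<leftarrow> [0, 1, 2], l \<leftarrow> [0, 1, 2], l \<noteq> k])
    (\<lambda>D. [[(D ! 0, 0), (D ! 1, 1), (D ! 2, 2)]])"
    by code_simp
qed

lemma scheme_0_3: "scheme 1 0 3"
proof (rule scheme_testD)
  show "scheme_test 1 0 3 (\<lambda>k. []) (\<lambda>D. [[(0, 0)], [(1, 0)], [(2, 0)]])"
    by code_simp
qed

lemma scheme_3_0: "scheme 1 3 0"
proof (rule scheme_testD)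
  show "scheme_test 1 3 0 (\<lambda>k. [[(0, 0)], [(1, 0)], [(2, 0)]]) (\<lambda>D. [])"
    by code_simp
qed

lemma scheme_3_5: "scheme 10 6 15"
proof (rule scheme_testD)
  show "scheme_test 10 6 15 cache10 (by_demand deliver10_distinct deliver10_two (\<lambda>a. [[(a, i)]. i \<leftarrow> [0..<10]]))"
    by code_simp
qed

subsection \<open>The trade-off\<close>

lemma scheme_mix:
  assumes 1: "scheme L m r" "L > 0" and 2: "scheme L' m' r'" "L' > 0" and ab: "a \<le> b" "b > 0"
  shows "linear_achievable (real a / real b * (real m / real L) + (1 - real a / real b) * (real m' / real L'))
     (real a / real b * (real r / real L) + (1 - real a / real b) * (real r' / real L'))"
proof (rule scheme_linear_achievable)
  \<comment> \<open>\<open>a * L'\<close> copies of the first scheme and \<open>(b - a) * L\<close>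
    of the second divide the files in the ratio \<open>a\<close> to \<open>b - a\<close>.\<close>
  let ?L = "a * L' * L + (b - a) * L * L'"
  show "scheme ?L (a * L' * m + (b - a) * L * m') (a * L' * r + (b - a) * L * r')"
    by (intro scheme_add scheme_scale 1 2)
  have L: "real ?L = real b * real L * real L'"
    using ab by (simp add: of_nat_diff algebra_simps)
  then show "?L > 0"
    using 1 2 ab by (metis mult_pos_pos of_nat_0_less_iff)
  have eq: "real (a * L' * x + (b - a) * L * x') =
      (real a / real b * (real x / real L) + (1 - real a / real b) * (real x' / real L')) * real ?L" for x x'
    unfolding L using 1 2 ab by (simp add: of_nat_diff field_simps)
  show "real (a * L' * m + (b - a) * L * m') \<le>
      (real a / real b * (real m / real L) + (1 - real a / real b) * (real m' / real L')) * real ?L"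
    by (rule eq_refl[OF eq])
  show "real (a * L' * r + (b - a) * L * r') \<le>
      (real a / real b * (real r / real L) + (1 - real a / real b) * (real r' / real L')) * real ?L"
    by (rule eq_refl[OF eq])
qed

lemma scheme_segment:
  assumes 1: "scheme L m r" "L > 0" and 2: "scheme L' m' r'" "L' > 0" and c: "0 \<le> c" "c \<le> 1"
    and M: "M = c * (real m / real L) + (1 - c) * (real m' / real L')"
    and R: "R = c * (real r / real L) + (1 - c) * (real r' / real L')"
  shows "(M, R) \<in> linear_region"
proof -
  define f where "f c = (c * (real m / real L) + (1 - c) * (real m' / real L'),
      c * (real r / real L) + (1 - c) * (real r' / real L'))" for c
  \<comment> \<open>Rational weights tending to \<open>c\<close>, which \<open>scheme_mix\<close>
    realises exactly.\<close>
  define q where "q n = real (nat \<lfloor>c * real (Suc n)\<rfloor>) / real (Suc n)" for n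
  have "f (q n) \<in> {(M, R). linear_achievable M R}" for n
  proof -
    have "\<lfloor>c * real (Suc n)\<rfloor> \<le> \<lfloor>real (Suc n)\<rfloor>"
      using c by (intro floor_mono) (simp add: mult_left_le_one_le)
    then have "nat \<lfloor>c * real (Suc n)\<rfloor> \<le> Suc n"
      by simp
    from scheme_mix[OF 1 2 this] show ?thesis
      by (simp add: f_def q_def)
  qed
  moreover have "q \<longlonglongrightarrow> c"
  proof (rule tendsto_sandwich[where f = "\<lambda>n. c - inverse (real (Suc n))" and h = "\<lambda>_. c"])
    have q: "q n = of_int \<lfloor>c * real (Suc n)\<rfloor> / real (Suc n)" for n
      using c by (simp add: q_def)
    have "c - inverse (real (Suc n)) \<le> q n" "q n \<le> c" for n
    proof -
      have "c * real (Suc n) - 1 \<le> of_int \<lfloor>c * real (Suc n)\<rfloor>" "of_int \<lfloor>c * real (Suc n)\<rfloor> \<le> c * real (Suc n)"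
        by linarith+
      then have "(c * real (Suc n) - 1) / real (Suc n) \<le> q n" "q n \<le> c * real (Suc n) / real (Suc n)"
        unfolding q by (intro divide_right_mono; simp)+
      then show "c - inverse (real (Suc n)) \<le> q n" "q n \<le> c"
        by (simp_all add: diff_divide_distrib inverse_eq_divide)
    qed
    then show "\<forall>\<^sub>F n in sequentially. c - inverse (real (Suc n)) \<le> q n" "\<forall>\<^sub>F n in sequentially. q n \<le> c"
      by simp_all
    show "(\<lambda>n. c - inverse (real (Suc n))) \<longlonglongrightarrow> c"
      using tendsto_diff[OF tendsto_const LIMSEQ_inverse_real_of_nat, of c] by simp
  qed simp
  then have "(\<lambda>n. f (q n)) \<longlonglongrightarrow> f c"
    unfolding f_def by (intro tendsto_intros)
  ultimately have "f c \<in> closure {(M, R). linear_achievable M R}"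
    unfolding closure_sequential by (intro exI[of _ "\<lambda>n. f (q n)"]) simp
  then show ?thesis
    by (simp add: f_def linear_region_def M R)
qed

lemma linear_achievable_bounds:
  assumes "linear_achievable M R"
  shows "3 \<le> 3 * M + R" "8 \<le> 6 * M + 3 * R" "15 \<le> 10 * M + 6 * R" "9 \<le> 5 * M + 4 * R"
    "5 \<le> 2 * M + 3 * R" "3 \<le> M + 3 * R"
proof -
  obtain G :: "(nat \<Rightarrow> nat) monoid" and N W Z Y where "group_caching G N W Z Y M R"
    using linear_achievable_group_caching[OF assms] by blast
  then interpret group_caching G N W Z Y M R .
  show "3 \<le> 3 * M + R" "8 \<le> 6 * M + 3 * R" "15 \<le> 10 * M + 6 * R" "9 \<le> 5 * M + 4 * R"
    "5 \<le> 2 * M + 3 * R" "3 \<le> M + 3 * R"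
    by (fact bound_cutset_M bound_6_3 bound_10_6 bound_5_4 bound_2_3 bound_cutset_R)+
qed

lemma linear_region_halfplane:
  assumes "(M, R) \<in> linear_region" and "\<And>M R. linear_achievable M R \<Longrightarrow> c \<le> a * M + b * R"
  shows "c \<le> a * M + b * R"
proof -
  have "closure {(M, R). linear_achievable M R} \<subseteq> {p. c \<le> a * fst p + b * snd p}"
  proof (rule closure_minimal)
    show "closed {p :: real \<times> real. c \<le> a * fst p + b * snd p}"
      by (intro closed_Collect_le continuous_intros)
  qed (use assms(2) in auto)
  then show ?thesis
    using assms(1) by (auto simp: linear_region_def)
qed

lemma R_L_star_eq:
  assumes "(M, R) \<in> linear_region"
    and "R = Max {3 - 3*M, (8 - 6*M)/3, (15 - 10*M)/6, (9 - 5*M)/4, (5 - 2*M)/3, (3 - M)/3}"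
  shows "R_L_star M = R"
  unfolding R_L_star_def
proof (rule cInf_eq_minimum)
  show "R \<in> {R. (M, R) \<in> linear_region}"
    using assms(1) by simp
  fix R' assume "R' \<in> {R. (M, R) \<in> linear_region}"
  then have "(M, R') \<in> linear_region"
    by simp
  note bound = linear_region_halfplane[OF this]
  have "3 \<le> 3 * M + 1 * R'" "8 \<le> 6 * M + 3 * R'" "15 \<le> 10 * M + 6 * R'" "9 \<le> 5 * M + 4 * R'"
    "5 \<le> 2 * M + 3 * R'" "3 \<le> 1 * M + 3 * R'"
    by (rule bound, use linear_achievable_bounds in simp)+
  then show "R \<le> R'"
    unfolding assms(2) by simp
qed

theorem theorem1:
  shows "(\<forall>M::real. 0 \<le> M \<and> M \<le> 3 \<longrightarrow>
           R_L_star M = Max {3 - 3*M, (8 - 6*M)/3, (15 - 10*M)/6, (9 - 5*M)/4,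
                             (5 - 2*M)/3, (3 - M)/3})
       \<and> (\<forall>M R. linear_achievable M R \<longrightarrow> 10*M + 6*R \<ge> 15 \<and> 5*M + 4*R \<ge> 9)
       \<and> linear_achievable (3/5) (3/2)"
proof (intro conjI allI impI)
  show "linear_achievable (3/5) (3/2)"
    by (rule scheme_linear_achievable[OF scheme_3_5]) simp_all
  show "10*M + 6*R \<ge> 15" "5*M + 4*R \<ge> 9" if "linear_achievable M R" for M R
    using linear_achievable_bounds[OF that] by simp_all
  fix M :: real assume "0 \<le> M \<and> M \<le> 3"
  \<comment> \<open>Consecutive lines of the maximum meet at the break points. In each case the
    weight \<open>c\<close> writes \<open>M\<close> as the convex combination of the cache sizes at
    the two ends.\<close>
  then consider "0 \<le> M" "M \<le> 1/3" | "1/3 \<le> M" "M \<le> 1/2" | "1/2 \<le> M" "M \<le> 3/5"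
    | "3/5 \<le> M" "M \<le> 1" | "1 \<le> M" "M \<le> 2" | "2 \<le> M" "M \<le> 3"
    by linarith
  then show "R_L_star M = Max {3 - 3*M, (8 - 6*M)/3, (15 - 10*M)/6, (9 - 5*M)/4, (5 - 2*M)/3, (3 - M)/3}"
  proof cases
    case 1
    moreover have "(M, 3 - 3*M) \<in> linear_region"
      by (rule scheme_segment[OF scheme_0_3 _ scheme_1_3, where c = "1 - 3*M"]) (use 1 in \<open>simp_all add: field_simps\<close>)
    ultimately show ?thesis
      by (subst R_L_star_eq[of M "3 - 3*M"]) (auto intro!: Max_eqI[symmetric])
  next
    case 2
    moreover have "(M, (8 - 6*M)/3) \<in> linear_region"
      by (rule scheme_segment[OF scheme_1_3 _ scheme_1_2, where c = "3 - 6*M"]) (use 2 in \<open>simp_all add: field_simps\<close>)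
    ultimately show ?thesis
      by (subst R_L_star_eq[of M "(8 - 6*M)/3"]) (auto intro!: Max_eqI[symmetric])
  next
    case 3
    moreover have "(M, (15 - 10*M)/6) \<in> linear_region"
      by (rule scheme_segment[OF scheme_1_2 _ scheme_3_5, where c = "6 - 10*M"]) (use 3 in \<open>simp_all add: field_simps\<close>)
    ultimately show ?thesis
      by (subst R_L_star_eq[of M "(15 - 10*M)/6"]) (auto intro!: Max_eqI[symmetric])
  next
    case 4
    moreover have "(M, (9 - 5*M)/4) \<in> linear_region"
      by (rule scheme_segment[OF scheme_3_5 _ scheme_1_1, where c = "(5 - 5*M)/2"]) (use 4 in \<open>simp_all add: field_simps\<close>)
    ultimately show ?thesis
      by (subst R_L_star_eq[of M "(9 - 5*M)/4"]) (auto intro!: Max_eqI[symmetric])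
  next
    case 5
    moreover have "(M, (5 - 2*M)/3) \<in> linear_region"
      by (rule scheme_segment[OF scheme_1_1 _ scheme_2_1, where c = "2 - M"]) (use 5 in \<open>simp_all add: field_simps\<close>)
    ultimately show ?thesis
      by (subst R_L_star_eq[of M "(5 - 2*M)/3"]) (auto intro!: Max_eqI[symmetric])
  next
    case 6
    moreover have "(M, (3 - M)/3) \<in> linear_region"
      by (rule scheme_segment[OF scheme_2_1 _ scheme_3_0, where c = "3 - M"]) (use 6 in \<open>simp_all add: field_simps\<close>)
    ultimately show ?thesis
      by (subst R_L_star_eq[of M "(3 - M)/3"]) (auto intro!: Max_eqI[symmetric])
  qed
qed

end
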